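(* Let $k\ge1$ be a natural number, let $\Psi(u)=u^k$ for $u\in[0,1]$ (the max-$k$ process), and let $F=F^\Psi$. Then there exists $C>0$ such that $F'(x)\sim Cx\exp(-kx)$ as $x\to\infty$.
   Context: $L^1_{\mathrm{loc}}$ is the space of locally integrable functions $[0,\infty)\to\mathbb R$ with its usual topology ($L^1$ convergence on compacts). $\mathcal D\subset L^1_{\mathrm{loc}}$ is the set of nondecreasing càdlàg functions $F:[0,\infty]\to[0,1]$. For $f\in L^1_{\mathrm{loc}}$ let $\|f\|_{x^{-2}}=\int_0^\infty x^{-2}|f(x)|\,dx\in[0,\infty]$, and $\mathcal D_1=\{F\in\mathcal D:\|F\|_{x^{-2}}\le1\}$. A "distribution function" is the cumulative distribution function of a probability measure (here on $[0,\infty)$). A family $\{F_\alpha\}$ of distribution functions on $[0,\infty)$ is tight if for every $\epsilon>0$ there is $N$ with $F_\alpha(N)>1-\epsilon$ for all $\alpha$. $\mathcal X$ (resp. $\mathcal X_1$) is the set of Borel measurable maps $\mathbf F=(\mathbf F_t)_{t\ge0}$ from $[0,\infty)$ to $\mathcal D$ (resp. $\mathcal D_1$). For $\mathbf F\in\mathcal X$, $$\mathscr S^\Psi(\mathbf F)_t(x)=\mathbf F_0(e^{-t}x)+\int_0^t(e^{s-t}x)^2\Big[\int_{e^{s-t}x}^\infty\frac1z\,d\Psi(\mathbf F_s(z))\Big]ds,$$ where $\int_y^\infty$ is over $(y,\infty)$ and $d\Psi(\mathbf F_s(z))$ is the Lebesgue–Stieltjes measure of $z\mapsto\Psi(\mathbf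 F_s(z))$. Set $$\mathfrak F=\{\mathbf F\in\mathcal X_1:\ \mathbf F=\mathscr S^\Psi(\mathbf F),\ \mathbf F_t(+\infty)=1\ \forall t\ge0,\ \{\mathbf F_t\}_{t\ge0}\text{ tight}\}.$$ For $\Psi$ continuous with $1-\Psi(u)\ge c(1-u)^{\kappa}$ on $(0,1)$ for some $c>0,\kappa\ge1$ (which holds here), $\mathfrak F\ne\emptyset$ and $F^\Psi$ denotes the unique distribution function in $\mathcal D_1$ such that $\|\mathbf F_t-F^\Psi\|_{x^{-2}}\le2e^{-t}$ for all $t\ge0$ and all $\mathbf F\in\mathfrak F$. It is continuously differentiable, satisfies $(F^\Psi)'(x)=x\int_x^\infty\frac1z\,d\Psi(F^\Psi(z))$ for all $x\ge0$, and $\|F^\Psi\|_{x^{-2}}=1$. The notation $f\sim g$ means $f/g\to1$. *)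

theory Defs
  imports "HOL-Probability.Probability" "HOL-Library.Landau_Symbols"
begin

section \<open>Locally integrable functions on the half-line\<close>

text \<open>
  Functions on \<open>[0,\<infinity>)\<close> are represented by functions on the reals of which only the values on
  \<open>{0..}\<close> matter; functions on \<open>[0,\<infinity>]\<close> have type \<^typ>\<open>ennreal \<Rightarrow> real\<close>, and their restriction
  to \<open>[0,\<infinity>)\<close> is \<open>fin_part\<close>.  Since \<^term>\<open>ennreal x = 0\<close> for negative \<open>x\<close>, \<open>fin_part F\<close> is
  constant on the negative half-line.
\<close>

definition fin_part :: "(ennreal \<Rightarrow> real) \<Rightarrow> real \<Rightarrow> real" where
  "fin_part F = (\<lambda>x. F (ennreal x))"

definition L1loc :: "(real \<Rightarrow> real) set" where
  "L1loc = {f. \<forall>N::real. set_integrable lborel {0..N} f}"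

definition L1loc_ball :: "(real \<Rightarrow> real) \<Rightarrow> real \<Rightarrow> real \<Rightarrow> (real \<Rightarrow> real) set" where
  "L1loc_ball f N \<epsilon> = {g \<in> L1loc. (LINT x:{0..N}|lborel. \<bar>g x - f x\<bar>) < \<epsilon>}"

text \<open>
  Functions are not identified when they agree almost everywhere on \<open>[0,\<infinity>)\<close>, so this topology is
  not Hausdorff; its open sets, and hence its Borel sets, are the preimages of those of the quotient.
\<close>

definition L1loc_topology :: "(real \<Rightarrow> real) topology" where
  "L1loc_topology = topology_generated_by {L1loc_ball f N \<epsilon> | f N \<epsilon>. f \<in> L1loc \<and> 0 < \<epsilon>}"

definition L1loc_borel :: "(real \<Rightarrow> real) measure" where
  "L1loc_borel = sigma L1loc {U. openin L1loc_topology U}"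

definition norm_xm2 :: "(real \<Rightarrow> real) \<Rightarrow> ennreal" where
  "norm_xm2 f = (\<integral>\<^sup>+ x \<in> {0..}. ennreal (\<bar>f x\<bar> / x\<^sup>2) \<partial>lborel)"


section \<open>Distribution functions\<close>

definition cadlag :: "(ennreal \<Rightarrow> real) \<Rightarrow> bool" where
  "cadlag F \<longleftrightarrow> (\<forall>x. continuous (at_right x) F \<and> (\<exists>l. (F \<longlongrightarrow> l) (at_left x)))"

definition D_set :: "(ennreal \<Rightarrow> real) set" where
  "D_set = {F. mono F \<and> cadlag F \<and> range F \<subseteq> {0..1}}"

definition D1_set :: "(ennreal \<Rightarrow> real) set" where
  "D1_set = {F \<in> D_set. norm_xm2 (fin_part F) \<le> 1}"

definition distribution_function :: "(ennreal \<Rightarrow> real) \<Rightarrow> bool" where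
  "distribution_function F \<longleftrightarrow>
     (\<exists>M. real_distribution M \<and> measure M {..<0} = 0 \<and>
          (\<forall>x\<ge>0. F (ennreal x) = cdf M x) \<and> F top = 1)"

definition tight_family :: "(real \<Rightarrow> ennreal \<Rightarrow> real) \<Rightarrow> bool" where
  "tight_family F \<longleftrightarrow> (\<forall>\<epsilon>>0. \<exists>N::real\<ge>0. \<forall>t\<ge>0. F t (ennreal N) > 1 - \<epsilon>)"


section \<open>The evolution equation\<close>

text \<open>Only the values at times \<open>t \<ge> 0\<close> matter.\<close>

definition X_set :: "(real \<Rightarrow> ennreal \<Rightarrow> real) set" where
  "X_set = {F. (\<forall>t\<ge>0. F t \<in> D_set) \<and>
               (\<lambda>t. fin_part (F t)) \<in> restrict_space borel {0..} \<rightarrow>\<^sub>M L1loc_borel}"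

definition X1_set :: "(real \<Rightarrow> ennreal \<Rightarrow> real) set" where
  "X1_set = {F \<in> X_set. \<forall>t\<ge>0. F t \<in> D1_set}"

text \<open>
  The inner integral is over the open interval \<open>(y,\<infinity>)\<close> in \<open>[0,\<infinity>)\<close>; a jump of \<open>F\<close> at \<open>+\<infinity>\<close> would
  not contribute, as \<open>1/z\<close> vanishes there.  At \<open>x = 0\<close> the inner integral may diverge; its
  prefactor is then \<open>0\<close> and so is the product.
\<close>

definition tail_integral :: "(real \<Rightarrow> real) \<Rightarrow> (ennreal \<Rightarrow> real) \<Rightarrow> real \<Rightarrow> real" where
  "tail_integral \<Psi> F y =
     (LINT z:{y<..}|interval_measure (\<lambda>z. \<Psi> (fin_part F z)). 1 / z)"

definition S_op ::
  "(real \<Rightarrow> real) \<Rightarrow> (real \<Rightarrow> ennreal \<Rightarrow> real) \<Rightarrow> real \<Rightarrow> real \<Rightarrow> real" where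
  "S_op \<Psi> F t x =
     fin_part (F 0) (exp (- t) * x) +
     (LINT s:{0..t}|lborel.
        (exp (s - t) * x)\<^sup>2 * tail_integral \<Psi> (F s) (exp (s - t) * x))"

definition solutions :: "(real \<Rightarrow> real) \<Rightarrow> (real \<Rightarrow> ennreal \<Rightarrow> real) set" where
  "solutions \<Psi> =
     {F \<in> X1_set.
        (\<forall>t\<ge>0. \<forall>x\<ge>0. fin_part (F t) x = S_op \<Psi> F t x) \<and>
        (\<forall>t\<ge>0. F t top = 1) \<and>
        tight_family F}"

definition F_Psi :: "(real \<Rightarrow> real) \<Rightarrow> ennreal \<Rightarrow> real" where
  "F_Psi \<Psi> =
     (THE G. distribution_function G \<and> G \<in> D1_set \<and>
        (\<forall>F \<in> solutions \<Psi>. \<forall>t\<ge>0.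
           norm_xm2 (\<lambda>x. fin_part (F t) x - fin_part G x) \<le> ennreal (2 * exp (- t))))"

end

theory Submission
  imports Defs "HOL-Real_Asymp.Real_Asymp"
begin

text \<open>
  For \<open>\<Psi>(u) = u\<^sup>k\<close> the limit \<open>F\<^sup>\<Psi>\<close> is described by ordinary differential equations.  Put
  \<open>h(x) = F'(x)/x\<close>.  The steady-state equation says that \<open>h(x)\<close> is the integral of \<open>1/z\<close> with respect
  to \<open>d(F(z)\<^sup>k)\<close> over \<open>(x, \<infinity>)\<close>, hence \<open>h' = - k F\<^sup>k\<^sup>-\<^sup>1 h\<close>.  As \<open>F\<close> tends to \<open>1\<close> exponentially
  fast, the logarithmic derivative of \<open>h(x) exp(k x)\<close> is integrable, and so this function has a finite
  positive limit \<open>C\<close> (lemma \<open>h_asymptotics\<close>); this is the claim.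

  It remains to identify \<open>F\<^sup>\<Psi>\<close>, which is defined by a limit property of the evolution equation,
  with a solution of this system.  A solution of \<open>G' = x h\<close>, \<open>h' = - k G\<^sup>k\<^sup>-\<^sup>1 h\<close> with \<open>G(0) = 0\<close> exists by
  Banach's fixed point theorem in a weighted space (\<open>ode_exists\<close>); it has a finite limit at infinity
  (\<open>G_limit\<close>), and a scaling symmetry of the system normalises this limit to \<open>1\<close>
  (\<open>rescaled_profile\<close>).  The resulting distribution function, constant in time, solves the
  evolution equation (\<open>steady_solution\<close>).

  Any two tight solutions of the evolution equation approach each other at the rate \<open>2 exp(-t)\<close>
  (\<open>contraction\<close>).  To see this, follow their difference \<open>D\<close> along the characteristics
  \<open>s \<mapsto> exp s * y\<close>.  With \<open>\<delta>\<close> the difference of the images under \<open>\<Psi>\<close>, which has the same sign as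
  \<open>D\<close>, the rate of change of \<open>D\<close> at the point \<open>x\<close> is the local loss term \<open>- x \<delta>(x)\<close> plus a gain term, \<open>x\<^sup>2\<close>
  times the integral of \<open>\<delta>(z)/z\<^sup>2\<close> over \<open>z > x\<close>.  Integrated over \<open>y\<close> with the weight
  \<open>1/y\<^sup>2\<close>, the gain of \<open>\<bar>D\<bar>\<close> is at most its loss, by exchanging the integrals.  Both may be infinite, so
  the argument is made for \<open>y \<le> R\<close>; the error is controlled by the values of \<open>\<bar>\<delta>\<bar>\<close> beyond \<open>R\<close>, which are
  small by tightness.  The weighted norm of \<open>D\<close> therefore does not grow in the coordinate \<open>y\<close>,
  and returning to \<open>x = exp t * y\<close> multiplies it by \<open>exp(-t)\<close>.

  Consequently the steady solution has the property that defines \<open>F\<^sup>\<Psi>\<close>, and it is the only function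
  with that property (\<open>F_Psi_eq_steady\<close>).
\<close>

section \<open>Solving the steady-state system\<close>

text \<open>
  The form of the mean value theorem used for the estimates of the fixed point argument.  The
  derivatives are compared on the open half-line; continuity takes care of the endpoint \<open>0\<close>.
\<close>

lemma abs_increment_le:
  fixes A B A' B' :: "real \<Rightarrow> real"
  assumes "continuous_on UNIV A" "continuous_on UNIV B"
    and "\<And>z. 0 < z \<Longrightarrow> (A has_real_derivative A' z) (at z)"
    and "\<And>z. 0 < z \<Longrightarrow> (B has_real_derivative B' z) (at z)"
    and "\<And>z. 0 < z \<Longrightarrow> \<bar>A' z\<bar> \<le> B' z" and "0 \<le> x"
  shows "\<bar>A x - A 0\<bar> \<le> B x - B 0"
proof -
  have "B 0 - A 0 \<le> B x - A x"
  proof (rule DERIV_nonneg_imp_increasing_open[OF \<open>0 \<le> x\<close>])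
    show "\<exists>y. ((\<lambda>x. B x - A x) has_real_derivative y) (at z) \<and> 0 \<le> y" if "0 < z" "z < x" for z
      using assms(5)[OF that(1)]
      by (intro exI[of _ "B' z - A' z"] conjI DERIV_diff assms that) auto
    show "continuous_on {0..x} (\<lambda>x. B x - A x)"
      by (intro continuous_intros continuous_on_subset[OF assms(1)] continuous_on_subset[OF assms(2)]) auto
  qed
  moreover have "B 0 + A 0 \<le> B x + A x"
  proof (rule DERIV_nonneg_imp_increasing_open[OF \<open>0 \<le> x\<close>])
    show "\<exists>y. ((\<lambda>x. B x + A x) has_real_derivative y) (at z) \<and> 0 \<le> y" if "0 < z" "z < x" for z
      using assms(5)[OF that(1)]
      by (intro exI[of _ "B' z + A' z"] conjI DERIV_add assms that) auto
    show "continuous_on {0..x} (\<lambda>x. B x + A x)"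
      by (intro continuous_intros continuous_on_subset[OF assms(1)] continuous_on_subset[OF assms(2)]) auto
  qed
  ultimately show ?thesis by linarith
qed

text \<open>
  For negative arguments the interval is empty and the primitive is \<open>0\<close>; this extends the
  solutions by constants to the whole line, where they are elements of the space of bounded
  continuous functions.
\<close>

definition primitive :: "(real \<Rightarrow> real) \<Rightarrow> real \<Rightarrow> real" where
  "primitive f x = integral {0..x} f"

lemma primitive_nonpos: "x \<le> 0 \<Longrightarrow> primitive f x = 0"
  by (cases "x = 0") (auto simp: primitive_def)

lemma primitive_DERIV:
  assumes "continuous_on UNIV f" "0 < x"
  shows "(primitive f has_real_derivative f x) (at x)"
proof -
  have "((\<lambda>x. integral {0..x} f) has_real_derivative f x) (at x within {0..x+1})"
    using assms by (intro integral_has_real_derivative continuous_on_subset[OF assms(1)]) auto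
  moreover have "at x within {0..x+1} = at x"
    using assms(2) by (intro at_within_interior) auto
  ultimately show ?thesis by (simp add: primitive_def[abs_def])
qed

lemma primitive_continuous:
  assumes "continuous_on UNIV f"
  shows "continuous_on UNIV (primitive f)"
proof -
  have *: "continuous_on {0..b} (primitive f)" for b
    unfolding primitive_def[abs_def]
    by (intro indefinite_integral_continuous_1 integrable_continuous_real continuous_on_subset[OF assms]) auto
  have "isCont (\<lambda>x. primitive f (max 0 x)) x" for x
  proof -
    have "continuous_on {x-1..x+1} (\<lambda>x. primitive f (max 0 x))"
      by (rule continuous_on_compose2[OF *[of "\<bar>x\<bar>+1"]]) (auto intro!: continuous_intros)
    then show ?thesis
      by (rule continuous_on_interior) auto
  qed
  moreover have "(\<lambda>x. primitive f (max 0 x)) = primitive f"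
    by (auto simp: fun_eq_iff max_def primitive_nonpos)
  ultimately show ?thesis by (simp add: continuous_on_eq_continuous_at)
qed

lemma abs_power_diff_le:
  fixes a b M :: real
  assumes "0 \<le> a" "a \<le> M" "0 \<le> b" "b \<le> M" "1 \<le> M"
  shows "\<bar>a ^ n - b ^ n\<bar> \<le> real n * M ^ n * \<bar>a - b\<bar>"
proof (induction n)
  case (Suc n)
  have "\<bar>a ^ Suc n - b ^ Suc n\<bar> = \<bar>a * (a ^ n - b ^ n) + (a - b) * b ^ n\<bar>"
    by (simp add: algebra_simps)
  also have "\<dots> \<le> a * \<bar>a ^ n - b ^ n\<bar> + \<bar>a - b\<bar> * b ^ n"
    using assms by (intro order_trans[OF abs_triangle_ineq]) (simp add: abs_mult)
  also have "\<dots> \<le> M * (real n * M ^ n * \<bar>a - b\<bar>) + \<bar>a - b\<bar> * M ^ Suc n"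
  proof (intro add_mono mult_mono Suc)
    have "b ^ n \<le> M ^ n" using assms by (intro power_mono) auto
    also have "\<dots> \<le> M ^ Suc n" using assms by (intro power_increasing) auto
    finally show "b ^ n \<le> M ^ Suc n" .
  qed (use assms in auto)
  also have "\<dots> = real (Suc n) * M ^ Suc n * \<bar>a - b\<bar>" by (simp add: algebra_simps)
  finally show ?case .
qed simp

lemma abs_exp_minus_diff_le:
  fixes a b :: real
  assumes "0 \<le> a" "0 \<le> b"
  shows "\<bar>exp (- a) - exp (- b)\<bar> \<le> \<bar>a - b\<bar>"
proof -
  have *: "exp (- a) - exp (- b) \<le> b - a" if "a \<le> b" "0 \<le> a" for a b :: real
  proof -
    have "1 - exp (- (b - a)) \<le> b - a"
      using exp_ge_add_one_self[of "- (b - a)"] by linarith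
    then have "exp (- a) * (1 - exp (- (b - a))) \<le> 1 * (b - a)"
      using that by (intro mult_mono) auto
    then show ?thesis by (simp add: algebra_simps flip: exp_add)
  qed
  show ?thesis
    using *[of a b] *[of b a] assms by (cases "a \<le> b") (auto simp: abs_if)
qed

text \<open>
  The right-hand side grows polynomially in \<open>G\<close>, so it is Lipschitz only locally.  Since every
  solution satisfies \<open>0 \<le> G x \<le> x\<^sup>2\<close>, it may be truncated to this range, where its Lipschitz
  constant at \<open>x\<close> is at most the polynomial \<open>L x\<close> below.  The Picard map is then a contraction of
  the space of \<open>G = w * u\<close> with \<open>u\<close> bounded and continuous, provided that the weight \<open>w\<close> grows
  fast enough, namely \<open>w' = 2 (1 + x) L w\<close>.  This gives a solution on the whole half-line at
  once, without continuation of local solutions.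
\<close>

lemma ode_exists:
  fixes k :: nat
  assumes k: "1 \<le> k"
  obtains G h :: "real \<Rightarrow> real" where "continuous_on UNIV G" "continuous_on UNIV h"
    "\<And>x. x \<le> 0 \<Longrightarrow> G x = 0" "\<And>x. 0 < h x"
    "\<And>x. 0 < x \<Longrightarrow> (G has_real_derivative x * h x) (at x)"
    "\<And>x. 0 < x \<Longrightarrow> (h has_real_derivative - (real k * G x ^ (k - 1) * h x)) (at x)"
proof -
  define L where "L z = real k * real k * (1 + z\<^sup>2) ^ k" for z :: real
  define w where "w x = exp (2 * primitive (\<lambda>z. (1 + z) * L z) x)" for x
  have contL: "continuous_on UNIV L"
    unfolding L_def by (intro continuous_intros)
  have contw: "continuous_on UNIV w"
    unfolding w_def by (intro continuous_intros primitive_continuous contL)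
  have wpos: "0 < w x" for x by (simp add: w_def)
  have L1: "1 \<le> L z" for z
  proof -
    have "1 * 1 * 1 \<le> L z" unfolding L_def
      using k by (intro mult_mono one_le_power) auto
    then show ?thesis by simp
  qed
  have derw: "(w has_real_derivative (2 * ((1 + x) * L x) * w x)) (at x)" if "0 < x" for x
    unfolding w_def
    by (rule derivative_eq_intros refl primitive_DERIV that continuous_intros contL | simp)+
  \<comment> \<open>the Picard map \<open>u \<mapsto> N u / w\<close>, with the truncation \<open>g\<close> of \<open>w u\<close> to \<open>[0, x\<^sup>2]\<close>\<close>
  define g where "g u x = max 0 (min (x\<^sup>2) (w x * apply_bcontfun u x))" for u x
  define I where "I u = primitive (\<lambda>x. real k * g u x ^ (k - 1))" for u
  define H where "H u x = exp (- I u x)" for u x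
  define N where "N u = primitive (\<lambda>y. y * H u y)" for u
  have contg: "continuous_on UNIV (g u)" for u
    unfolding g_def by (intro continuous_intros contw) auto
  have contI: "continuous_on UNIV (I u)" for u
    unfolding I_def by (intro primitive_continuous continuous_intros contg)
  have contH: "continuous_on UNIV (H u)" for u
    unfolding H_def by (intro continuous_intros contI)
  have contN: "continuous_on UNIV (N u)" for u
    unfolding N_def by (intro primitive_continuous continuous_intros contH)
  have derI: "(I u has_real_derivative real k * g u x ^ (k - 1)) (at x)" if "0 < x" for u x
    unfolding I_def by (rule primitive_DERIV[OF _ that]) (intro continuous_intros contg)
  have derN: "(N u has_real_derivative x * H u x) (at x)" if "0 < x" for u x
    unfolding N_def by (rule primitive_DERIV[OF _ that]) (intro continuous_intros contH)
  have I0: "I u x = 0" if "x \<le> 0" for u x using that by (simp add: I_def primitive_nonpos)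
  have N0: "N u x = 0" if "x \<le> 0" for u x using that by (simp add: N_def primitive_nonpos)
  have g0: "0 \<le> g u x" "g u x \<le> x\<^sup>2" for u x by (auto simp: g_def)
  have Ipos: "0 \<le> I u x" for u x
  proof (cases "x \<le> 0")
    case False
    have "\<bar>I u x - I u 0\<bar> \<le> I u x - I u 0"
      by (rule abs_increment_le[OF contI contI derI derI]) (use False g0 in auto)
    then show ?thesis by (simp add: I0)
  qed (simp add: I0)
  have H01: "0 < H u x" "H u x \<le> 1" for u x using Ipos by (auto simp: H_def)
  \<comment> \<open>Each of the two integrations in the Picard map gains a factor \<open>1/2\<close> from
      \<open>L w \<le> w'/2\<close> and \<open>x w \<le> w'/2\<close>.\<close>
  have Ndiff: "\<bar>N u x - N v x\<bar> \<le> dist u v / 4 * w x" for u v x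
  proof (cases "x \<le> 0")
    case True
    then show ?thesis using wpos[of x] by (simp add: N0)
  next
    case False
    let ?d = "dist u v"
    have gd: "\<bar>g u z - g v z\<bar> \<le> w z * ?d" for z
    proof -
      have "\<bar>g u z - g v z\<bar> \<le> \<bar>w z * apply_bcontfun u z - w z * apply_bcontfun v z\<bar>"
        unfolding g_def by (auto simp: max_def min_def)
      also have "\<dots> = w z * dist (apply_bcontfun u z) (apply_bcontfun v z)"
        using wpos[of z] by (simp add: dist_real_def abs_mult flip: right_diff_distrib)
      also have "\<dots> \<le> w z * ?d"
        using wpos[of z] by (intro mult_left_mono dist_bounded) auto
      finally show ?thesis .
    qed
    have Id: "\<bar>I u z - I v z\<bar> \<le> ?d / 2 * w z" if "0 \<le> z" for z
    proof -
      have "\<bar>(I u z - I v z) - (I u 0 - I v 0)\<bar> \<le> ?d / 2 * w z - ?d / 2 * w 0"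
      proof (rule abs_increment_le[where A' = "\<lambda>z. real k * g u z ^ (k - 1) - real k * g v z ^ (k - 1)"
            and B' = "\<lambda>z. ?d / 2 * (2 * ((1 + z) * L z) * w z)", OF _ _ _ _ _ that])
        fix z :: real assume z: "0 < z"
        have "\<bar>real k * g u z ^ (k - 1) - real k * g v z ^ (k - 1)\<bar>
            = real k * \<bar>g u z ^ (k - 1) - g v z ^ (k - 1)\<bar>"
          by (simp add: abs_mult flip: right_diff_distrib)
        also have "\<dots> \<le> real k * (real (k - 1) * (1 + z\<^sup>2) ^ (k - 1) * \<bar>g u z - g v z\<bar>)"
          using g0[of u z] g0[of v z] by (intro mult_left_mono abs_power_diff_le) auto
        also have "\<dots> \<le> real k * (real k * (1 + z\<^sup>2) ^ k * (w z * ?d))"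
          using wpos[of z] by (intro mult_left_mono mult_mono gd power_increasing) auto
        also have "\<dots> = 1 * L z * w z * ?d" by (simp add: L_def)
        also have "\<dots> \<le> (1 + z) * L z * w z * ?d"
          using z L1[of z] wpos[of z] by (intro mult_right_mono) auto
        finally show "\<bar>real k * g u z ^ (k - 1) - real k * g v z ^ (k - 1)\<bar> \<le> ?d / 2 * (2 * ((1 + z) * L z) * w z)"
          by (simp add: field_simps)
        show "((\<lambda>z. I u z - I v z) has_real_derivative real k * g u z ^ (k - 1) - real k * g v z ^ (k - 1)) (at z)"
          by (intro DERIV_diff derI z)
        show "((\<lambda>z. ?d / 2 * w z) has_real_derivative ?d / 2 * (2 * ((1 + z) * L z) * w z)) (at z)"
          by (intro DERIV_cmult derw z)
      qed (intro continuous_intros contI contw)+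
      moreover have "0 \<le> ?d / 2 * w 0" using wpos[of 0] by simp
      ultimately show ?thesis by (simp add: I0)
    qed
    have Hd: "\<bar>H u z - H v z\<bar> \<le> ?d / 2 * w z" if "0 \<le> z" for z
      unfolding H_def using abs_exp_minus_diff_le[OF Ipos Ipos] Id[OF that] by (rule order_trans)
    have "\<bar>(N u x - N v x) - (N u 0 - N v 0)\<bar> \<le> ?d / 4 * w x - ?d / 4 * w 0"
    proof (rule abs_increment_le[where A' = "\<lambda>z. z * H u z - z * H v z"
            and B' = "\<lambda>z. ?d / 4 * (2 * ((1 + z) * L z) * w z)"])
      fix z :: real assume z: "0 < z"
      have "\<bar>z * H u z - z * H v z\<bar> = z * \<bar>H u z - H v z\<bar>"
        using z by (simp add: abs_mult flip: right_diff_distrib)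
      also have "\<dots> \<le> ((1 + z) * L z) * (?d / 2 * w z)"
      proof (intro mult_mono Hd)
        have "z * 1 \<le> (1 + z) * L z" using z L1 by (intro mult_mono) auto
        then show "z \<le> (1 + z) * L z" by simp
      qed (use z L1[of z] in auto)
      finally show "\<bar>z * H u z - z * H v z\<bar> \<le> ?d / 4 * (2 * ((1 + z) * L z) * w z)"
        by (simp add: algebra_simps)
      show "((\<lambda>z. N u z - N v z) has_real_derivative z * H u z - z * H v z) (at z)"
        by (intro DERIV_diff derN z)
      show "((\<lambda>z. ?d / 4 * w z) has_real_derivative ?d / 4 * (2 * ((1 + z) * L z) * w z)) (at z)"
        by (intro DERIV_cmult derw z)
    qed (use False in \<open>auto intro!: continuous_intros contN contw\<close>)
    moreover have "0 \<le> ?d / 4 * w 0" using wpos[of 0] by simp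
    ultimately show ?thesis by (simp add: N0)
  qed
  have Nw: "\<bar>N u x\<bar> \<le> w x" for u x
  proof (cases "x \<le> 0")
    case True
    then show ?thesis using wpos[of x] by (simp add: N0)
  next
    case False
    have "\<bar>N u x - N u 0\<bar> \<le> w x - w 0"
    proof (rule abs_increment_le[where A' = "\<lambda>z. z * H u z"
            and B' = "\<lambda>z. (2 * ((1 + z) * L z) * w z)", OF contN contw derN derw])
      fix z :: real assume z: "0 < z"
      have "\<bar>w y - w 0\<bar> \<le> w y - w 0" if "0 \<le> y" for y
      proof (rule abs_increment_le[OF contw contw derw derw _ that])
        fix z :: real assume "0 < z"
        then have "0 \<le> 2 * ((1 + z) * L z) * w z"
          using L1[of z] wpos[of z] by (intro mult_nonneg_nonneg) auto
        then show "\<bar>2 * ((1 + z) * L z) * w z\<bar> \<le> 2 * ((1 + z) * L z) * w z" by simp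
      qed
      from this[of z] z have w1: "1 \<le> w z" by (simp add: w_def primitive_nonpos)
      have "z * H u z * 1 \<le> (2 * ((1 + z) * L z)) * w z"
      proof (rule mult_mono)
        have "z * H u z \<le> (1 + z) * L z"
          using z order_trans[OF H01(2) L1] less_imp_le[OF H01(1)] by (intro mult_mono) auto
        also have "\<dots> \<le> 2 * ((1 + z) * L z)" using z L1[of z] by simp
        finally show "z * H u z \<le> 2 * ((1 + z) * L z)" .
      qed (use z w1 L1[of z] in auto)
      then show "\<bar>z * H u z\<bar> \<le> (2 * ((1 + z) * L z) * w z)"
        using z H01[of u z] by simp
    qed (use False in auto)
    then show ?thesis using wpos[of 0] by (simp add: N0)
  qed
  define T where "T u = Bcontfun (\<lambda>x. N u x / w x)" for u
  have T: "apply_bcontfun (T u) x = N u x / w x" for u x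
    unfolding T_def
  proof (subst Bcontfun_inverse)
    show "(\<lambda>x. N u x / w x) \<in> bcontfun"
    proof (rule bcontfun_normI)
      show "continuous_on UNIV (\<lambda>x. N u x / w x)"
        using wpos by (intro continuous_intros contN contw) (auto simp: less_imp_neq[symmetric])
      show "norm (N u x / w x) \<le> 1" for x
        using Nw[of u x] wpos[of x] by (simp add: divide_le_eq)
    qed
  qed simp
  have "dist (T u) (T v) \<le> 1 / 4 * dist u v" for u v
  proof (rule dist_bound)
    fix x
    have "dist (apply_bcontfun (T u) x) (apply_bcontfun (T v) x) = \<bar>N u x - N v x\<bar> / w x"
      using wpos[of x] by (simp add: T dist_real_def flip: diff_divide_distrib)
    then show "dist (apply_bcontfun (T u) x) (apply_bcontfun (T v) x) \<le> 1 / 4 * dist u v"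
      using Ndiff[of u x v] wpos[of x] by (simp add: divide_le_eq)
  qed
  then have "\<exists>!u. T u = u"
    by (intro banach_fix_type[of "1/4"]) auto
  then obtain u where u: "T u = u" by blast
  have wu: "w x * apply_bcontfun u x = N u x" for x
    using T[of u x] wpos[of x] by (simp add: u field_simps)
  have "\<bar>N u x - N u 0\<bar> \<le> x\<^sup>2 - 0\<^sup>2" if "0 \<le> x" for x
  proof (rule abs_increment_le[where B' = "\<lambda>z. 2 * z", OF contN _ derN _ _ that])
    fix z :: real assume z: "0 < z"
    have "z * H u z \<le> 2 * z" using z H01(2)[of u z] by simp
    then show "\<bar>z * H u z\<bar> \<le> 2 * z" using z H01[of u z] by simp
  qed (auto intro!: continuous_intros derivative_eq_intros)
  then have Nb: "\<bar>N u x\<bar> \<le> x\<^sup>2" for x by (cases "x \<le> 0") (auto simp: N0)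
  have Npos: "0 \<le> N u x" for x
  proof (cases "x \<le> 0")
    case False
    have "\<bar>N u x - N u 0\<bar> \<le> N u x - N u 0"
      by (rule abs_increment_le[OF contN contN derN derN]) (use False H01(1)[of u] in \<open>auto simp: abs_mult less_imp_le\<close>)
    then show ?thesis by (simp add: N0)
  qed (simp add: N0)
  \<comment> \<open>the fixed point is not affected by the truncation\<close>
  have gN: "g u x = N u x" for x
    using Nb[of x] Npos[of x] by (simp add: g_def wu)
  show thesis
  proof (rule that[of "N u" "H u"])
    show "(N u has_real_derivative x * H u x) (at x)" if "0 < x" for x by (rule derN[OF that])
    show "(H u has_real_derivative - (real k * N u x ^ (k - 1) * H u x)) (at x)" if "0 < x" for x
      unfolding H_def by (rule derivative_eq_intros refl derI that | simp add: gN)+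
  qed (use contN contH N0 H01 in auto)
qed

section \<open>Tail behaviour and normalisation of the profile\<close>

lemma nonincreasing_if_deriv_nonpos:
  fixes f f' :: "real \<Rightarrow> real"
  assumes "continuous_on UNIV f"
    and "\<And>z. 0 < z \<Longrightarrow> (f has_real_derivative f' z) (at z)"
    and "\<And>z. a < z \<Longrightarrow> f' z \<le> 0" and "0 \<le> a" "a \<le> x" "x \<le> y"
  shows "f y \<le> f x"
proof -
  have "- f x \<le> - f y"
  proof (rule DERIV_nonneg_imp_increasing_open[OF \<open>x \<le> y\<close>])
    show "\<exists>d. ((\<lambda>x. - f x) has_real_derivative d) (at z) \<and> 0 \<le> d" if "x < z" "z < y" for z
      using assms(3)[of z] that assms
      by (intro exI[of _ "- f' z"] conjI DERIV_minus) auto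
    show "continuous_on {x..y} (\<lambda>x. - f x)"
      by (intro continuous_intros continuous_on_subset[OF assms(1)]) auto
  qed
  then show ?thesis by simp
qed

lemma nondecreasing_bounded_tendsto:
  fixes f :: "real \<Rightarrow> real"
  assumes mono: "\<And>x y. 0 \<le> x \<Longrightarrow> x \<le> y \<Longrightarrow> f x \<le> f y" and bd: "\<And>x. 0 \<le> x \<Longrightarrow> f x \<le> M"
  obtains l where "(f \<longlongrightarrow> l) at_top" "\<And>x. 0 \<le> x \<Longrightarrow> f x \<le> l" "l \<le> M"
proof -
  let ?g = "\<lambda>x. f (max 0 x)"
  have "incseq (\<lambda>n. f (real n))" by (auto simp: incseq_def intro!: mono)
  then obtain l where l: "(\<lambda>n. f (real n)) \<longlonglongrightarrow> l" "\<And>n. f (real n) \<le> l"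
    using incseq_convergent[of "\<lambda>n. f (real n)" M] bd by auto
  have "(?g \<longlongrightarrow> l) at_top"
    using l(1) by (intro tendsto_at_topI_sequentially_real) (auto simp: mono_def intro!: mono)
  moreover have "\<forall>\<^sub>F x in at_top. ?g x = f x"
    using eventually_ge_at_top[of 0] by eventually_elim auto
  ultimately have "(f \<longlongrightarrow> l) at_top" by (rule Lim_transform_eventually)
  moreover have "f x \<le> l" if "0 \<le> x" for x
    using mono[OF that, of "real (nat \<lceil>x\<rceil>)"] l(2)[of "nat \<lceil>x\<rceil>"] by linarith
  moreover have "l \<le> M" using l(1) bd by (intro LIMSEQ_le_const2) auto
  ultimately show thesis using that by blast
qed

lemma x_exp_minus_le:
  fixes x c :: real
  assumes "0 < c"
  shows "x * exp (- c * x) \<le> 1 / c"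
proof -
  have "c * x \<le> exp (c * x)" using exp_ge_add_one_self[of "c * x"] by linarith
  then have "c * x * exp (- c * x) \<le> exp (c * x) * exp (- c * x)" by (intro mult_right_mono) auto
  then show ?thesis using assms by (simp add: field_simps flip: exp_add)
qed

text \<open>
  With \<open>h(x)\<close> the integral of \<open>1/z\<close> with respect to \<open>d(G(z)\<^sup>k)\<close> over \<open>(x, \<infinity>)\<close>, the
  steady-state equation \<open>G'(x) = x h(x)\<close> becomes this system of ordinary differential equations,
  because \<open>h'(x) = - (G\<^sup>k)'(x) / x\<close>.
\<close>

locale profile =
  fixes k :: nat and G h :: "real \<Rightarrow> real"
  assumes k_ge_1: "1 \<le> k"
    and G_continuous: "continuous_on UNIV G" and h_continuous: "continuous_on UNIV h"
    and G_nonpos: "x \<le> 0 \<Longrightarrow> G x = 0" and h_pos: "0 < h x"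
    and G_DERIV: "0 < x \<Longrightarrow> (G has_real_derivative x * h x) (at x)"
    and h_DERIV: "0 < x \<Longrightarrow> (h has_real_derivative - (real k * G x ^ (k - 1) * h x)) (at x)"
begin

lemma G_mono: "x \<le> y \<Longrightarrow> G x \<le> G y"
proof -
  have *: "G x \<le> G y" if "0 \<le> x" "x \<le> y" for x y
  proof -
    have "- G y \<le> - G x"
      by (rule nonincreasing_if_deriv_nonpos[where f = "\<lambda>x. - G x" and a = x and f' = "\<lambda>x. - (x * h x)"])
        (use that h_pos in \<open>auto intro!: continuous_intros G_continuous derivative_eq_intros G_DERIV simp: less_imp_le\<close>)
    then show ?thesis by simp
  qed
  show "G x \<le> G y" if "x \<le> y"
    using *[of x y] *[of 0 y] that by (cases "0 \<le> x"; cases "0 \<le> y") (auto simp: G_nonpos)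
qed

lemma G_nonneg: "0 \<le> G x"
  using G_mono[of 0 x] by (cases "0 \<le> x") (auto simp: G_nonpos)

lemma G_pos:
  assumes "0 < x"
  shows "0 < G x"
proof -
  have "G 0 < G x"
  proof (rule DERIV_pos_imp_increasing_open[OF assms])
    show "\<exists>y. (G has_real_derivative y) (at z) \<and> 0 < y" if "0 < z" for z
      using G_DERIV[OF that] h_pos[of z] that by (intro exI[of _ "z * h z"]) auto
  qed (auto intro: continuous_on_subset[OF G_continuous])
  then show ?thesis by (simp add: G_nonpos)
qed

lemma h_nonincreasing: "0 \<le> x \<Longrightarrow> x \<le> y \<Longrightarrow> h y \<le> h x"
proof (rule nonincreasing_if_deriv_nonpos[OF h_continuous h_DERIV, of x])
  show "- (real k * G z ^ (k - 1) * h z) \<le> 0" for z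
    using h_pos[of z] G_nonneg[of z] by (simp add: less_imp_le)
qed auto

text \<open>
  Beyond \<open>x = 1\<close> the logarithmic derivative of \<open>h\<close> is at most \<open>- k * G 1 ^ (k - 1)\<close>, by
  monotonicity of \<open>G\<close>.
\<close>

lemma h_exponential_decay:
  obtains b K where "0 < b" "0 < K" "\<And>x. 0 \<le> x \<Longrightarrow> h x \<le> K * exp (- b * x)"
proof -
  define b where "b = real k * G 1 ^ (k - 1)"
  have b: "0 < b" using k_ge_1 G_pos[of 1] by (simp add: b_def)
  have "h x \<le> (h 0 * exp b) * exp (- b * x)" if "0 \<le> x" for x
  proof (cases "x \<le> 1")
    case True
    have "h x * 1 \<le> h 0 * exp (b * (1 - x))"
      using b True that h_pos[of 0] h_nonincreasing[of 0 x] by (intro mult_mono) auto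
    then show ?thesis by (simp add: right_diff_distrib exp_diff exp_minus field_simps)
  next
    case False
    have "h x * exp (b * x) \<le> h 1 * exp (b * 1)"
    proof (rule nonincreasing_if_deriv_nonpos[where f = "\<lambda>x. h x * exp (b * x)" and a = 1
          and f' = "\<lambda>x. (b - real k * G x ^ (k - 1)) * (h x * exp (b * x))"])
      fix z :: real assume "1 < z"
      then have "b \<le> real k * G z ^ (k - 1)"
        unfolding b_def using G_nonneg by (intro mult_left_mono power_mono G_mono) auto
      then show "(b - real k * G z ^ (k - 1)) * (h z * exp (b * z)) \<le> 0"
        using h_pos[of z] by (intro mult_nonpos_nonneg) auto
    next
      fix z :: real assume "0 < z"
      then show "((\<lambda>x. h x * exp (b * x)) has_real_derivative (b - real k * G z ^ (k - 1)) * (h z * exp (b * z))) (at z)"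
        by (auto intro!: derivative_eq_intros h_DERIV simp: algebra_simps)
    qed (use False in \<open>auto intro!: continuous_intros h_continuous\<close>)
    also have "\<dots> \<le> h 0 * exp b" using h_nonincreasing[of 0 1] by simp
    finally have "h x * exp (b * x) * exp (- b * x) \<le> h 0 * exp b * exp (- b * x)"
      by (intro mult_right_mono) auto
    then show ?thesis by (simp add: mult.assoc flip: exp_add)
  qed
  then show thesis using that[of b "h 0 * exp b"] b h_pos[of 0] by simp
qed

text \<open>
  The tail of \<open>G' = x h\<close> is dominated by an exponential: with \<open>B\<close> as in the proof,
  \<open>G + B exp(- c x)\<close> is nonincreasing, which bounds \<open>G\<close> and gives the rate of convergence.
\<close>

lemma G_limit:
  obtains l c B where "(G \<longlongrightarrow> l) at_top" "0 < l" "\<And>x. G x \<le> l" "0 < c" "0 \<le> B"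
    "\<And>x. 0 \<le> x \<Longrightarrow> l - G x \<le> B * exp (- c * x)"
proof -
  obtain b K where bK: "0 < b" "0 < K" and hK: "\<And>x. 0 \<le> x \<Longrightarrow> h x \<le> K * exp (- b * x)"
    by (rule h_exponential_decay) blast
  define c where "c = b / 2"
  define B where "B = K / c\<^sup>2"
  have c: "0 < c" and b: "b = c + c" using bK by (simp_all add: c_def)
  have B: "0 \<le> B" using bK by (simp add: B_def)
  have dec: "G y + B * exp (- c * y) \<le> G x + B * exp (- c * x)" if "0 \<le> x" "x \<le> y" for x y
  proof (rule nonincreasing_if_deriv_nonpos[where f = "\<lambda>x. G x + B * exp (- c * x)" and a = 0
        and f' = "\<lambda>x. x * h x - B * c * exp (- c * x)"])
    fix z :: real assume z: "0 < z"
    have "z * h z \<le> z * (K * exp (- b * z))" using z by (intro mult_left_mono hK) auto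
    also have "\<dots> = (z * exp (- c * z)) * (K * exp (- c * z))"
      by (simp add: b algebra_simps flip: exp_add)
    also have "\<dots> \<le> 1 / c * (K * exp (- c * z))"
      using bK by (intro mult_right_mono x_exp_minus_le c) auto
    also have "\<dots> = B * c * exp (- c * z)" using c by (simp add: B_def power2_eq_square)
    finally show "z * h z - B * c * exp (- c * z) \<le> 0" by simp
    show "((\<lambda>x. G x + B * exp (- c * x)) has_real_derivative z * h z - B * c * exp (- c * z)) (at z)"
      using z by (auto intro!: derivative_eq_intros G_DERIV)
  qed (use that in \<open>auto intro!: continuous_intros G_continuous\<close>)
  have G_le_B: "G x \<le> B" if "0 \<le> x" for x
    using dec[of 0 x] that mult_nonneg_nonneg[OF B, of "exp (- c * x)"] by (simp add: G_nonpos)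
  obtain l where l: "(G \<longlongrightarrow> l) at_top" "\<And>x. 0 \<le> x \<Longrightarrow> G x \<le> l"
    by (rule nondecreasing_bounded_tendsto[of G B]) (auto intro: G_mono G_le_B)
  have lpos: "0 < l" using G_pos[of 1] l(2)[of 1] by simp
  have "l - G x \<le> B * exp (- c * x)" if "0 \<le> x" for x
  proof -
    have "l \<le> G x + B * exp (- c * x)"
    proof (rule tendsto_upperbound[OF l(1)])
      show "\<forall>\<^sub>F y in at_top. G y \<le> G x + B * exp (- c * x)"
        using eventually_ge_at_top[of x]
      proof eventually_elim
        case (elim y)
        then show ?case using dec[OF that elim] mult_nonneg_nonneg[OF B, of "exp (- c * y)"] by simp
      qed
    qed simp
    then show ?thesis by simp
  qed
  moreover have "G x \<le> l" for x using l(2)[of x] lpos by (cases "0 \<le> x") (auto simp: G_nonpos)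
  ultimately show thesis using that[OF l(1) lpos _ c B] by blast
qed

text \<open>
  The system has a one-parameter group of scalings.  It replaces a shooting argument: any solution
  can be normalised to have limit \<open>1\<close> at infinity.
\<close>

lemma rescaled_profile:
  assumes "0 < c"
  shows "profile k (\<lambda>x. c * G (c ^ (k - 1) * x)) (\<lambda>x. c * (c ^ (k - 1))\<^sup>2 * h (c ^ (k - 1) * x))"
proof -
  define l where "l = c ^ (k - 1)"
  have l: "0 < l" using assms by (simp add: l_def)
  have chain: "((\<lambda>x. f (l * x)) has_real_derivative f' * l) (at x)"
    if "(f has_real_derivative f') (at (l * x))" for f f' x
    by (rule DERIV_chain2[where g = "\<lambda>x. l * x" and f = f, OF that])
      (auto intro!: derivative_eq_intros)
  have "profile k (\<lambda>x. c * G (l * x)) (\<lambda>x. c * l\<^sup>2 * h (l * x))"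
  proof
    show "1 \<le> k" by (rule k_ge_1)
    show "continuous_on UNIV (\<lambda>x. c * G (l * x))"
      by (intro continuous_intros continuous_on_compose2[OF G_continuous]) auto
    show "continuous_on UNIV (\<lambda>x. c * l\<^sup>2 * h (l * x))"
      by (intro continuous_intros continuous_on_compose2[OF h_continuous]) auto
    show "c * G (l * x) = 0" if "x \<le> 0" for x
      using that l by (simp add: G_nonpos mult_le_0_iff)
    show "0 < c * l\<^sup>2 * h (l * x)" for x using assms l h_pos[of "l * x"] by simp
    show "((\<lambda>x. c * G (l * x)) has_real_derivative x * (c * l\<^sup>2 * h (l * x))) (at x)" if "0 < x" for x
      using DERIV_cmult[OF chain[OF G_DERIV[of "l * x"]], of c] that l
      by (simp add: power2_eq_square mult_ac)
    show "((\<lambda>x. c * l\<^sup>2 * h (l * x)) has_real_derivative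
        - (real k * (c * G (l * x)) ^ (k - 1) * (c * l\<^sup>2 * h (l * x)))) (at x)" if "0 < x" for x
      using DERIV_cmult[OF chain[OF h_DERIV[of "l * x"]], of "c * l\<^sup>2"] that l
      by (simp add: power_mult_distrib mult_ac l_def[symmetric, unfolded One_nat_def])
  qed
  then show ?thesis by (simp only: l_def)
qed

end

locale unit_profile = profile +
  assumes G_tendsto_1: "(G \<longlongrightarrow> 1) at_top"

lemma unit_profile_exists:
  assumes "1 \<le> k"
  obtains G h where "unit_profile k G h"
proof -
  obtain G h where "profile k G h"
    by (rule ode_exists[OF assms]) (metis profile.intro assms)
  then interpret profile k G h .
  obtain l where l: "(G \<longlongrightarrow> l) at_top" "0 < l" by (rule G_limit)
  define c where "c = 1 / l"
  have c: "0 < c" using l by (simp add: c_def)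
  interpret P: profile k "\<lambda>x. c * G (c ^ (k - 1) * x)" "\<lambda>x. c * (c ^ (k - 1))\<^sup>2 * h (c ^ (k - 1) * x)"
    by (rule rescaled_profile[OF c])
  have "filterlim (\<lambda>x. c ^ (k - 1) * x) at_top at_top"
    using c by (intro filterlim_tendsto_pos_mult_at_top[OF tendsto_const _ filterlim_ident]) auto
  then have "((\<lambda>x. c * G (c ^ (k - 1) * x)) \<longlongrightarrow> c * l) at_top"
    by (intro tendsto_intros filterlim_compose[OF l(1)])
  then have "unit_profile k (\<lambda>x. c * G (c ^ (k - 1) * x)) (\<lambda>x. c * (c ^ (k - 1))\<^sup>2 * h (c ^ (k - 1) * x))"
    using l by unfold_locales (simp add: c_def)
  then show thesis by (rule that)
qed

context unit_profile
begin

lemma G_le_1: "G x \<le> 1"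
  by (rule tendsto_lowerbound[OF G_tendsto_1 eventually_mono[OF eventually_ge_at_top[of x]]])
    (auto intro: G_mono)

lemma xh_tendsto_0: "((\<lambda>x. x * h x) \<longlongrightarrow> 0) at_top"
proof -
  obtain b K where bK: "0 < b" "0 < K" and hK: "\<And>x. 0 \<le> x \<Longrightarrow> h x \<le> K * exp (- b * x)"
    by (rule h_exponential_decay) blast
  have "((\<lambda>x. K * (x * exp (- b * x))) \<longlongrightarrow> K * 0) at_top"
    by (intro tendsto_intros) (use bK in real_asymp)
  then have lim: "((\<lambda>x. K * (x * exp (- b * x))) \<longlongrightarrow> 0) at_top" by simp
  show ?thesis
  proof (rule tendsto_sandwich[OF _ _ tendsto_const lim])
    show "\<forall>\<^sub>F x in at_top. 0 \<le> x * h x"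
      using eventually_ge_at_top[of 0] by eventually_elim (use h_pos in \<open>auto simp: less_imp_le\<close>)
    show "\<forall>\<^sub>F x in at_top. x * h x \<le> K * (x * exp (- b * x))"
      using eventually_ge_at_top[of 0]
    proof eventually_elim
      case (elim x)
      then show ?case using mult_left_mono[OF hK[OF elim] elim] by (simp add: mult_ac)
    qed
  qed
qed

lemma h_tendsto_0: "(h \<longlongrightarrow> 0) at_top"
proof (rule tendsto_sandwich[OF _ _ tendsto_const xh_tendsto_0])
  show "\<forall>\<^sub>F x in at_top. 0 \<le> h x" using h_pos by (simp add: less_imp_le)
  show "\<forall>\<^sub>F x in at_top. h x \<le> x * h x"
    using eventually_ge_at_top[of 1] by eventually_elim (simp add: h_pos less_imp_le)
qed

text \<open>
  Since \<open>h'/h = - k G\<^sup>k\<^sup>-\<^sup>1\<close>, the function \<open>m(x) = h(x) exp(k x)\<close> satisfies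
  \<open>m'/m = k (1 - G\<^sup>k\<^sup>-\<^sup>1)\<close>, which is nonnegative and, by Bernoulli's inequality, at most
  \<open>k\<^sup>2 (1 - G)\<close>.  This is integrable by the exponential tail of \<open>1 - G\<close>, so \<open>m\<close> increases to a
  finite positive limit.
\<close>

lemma h_asymptotics:
  obtains C where "0 < C" "((\<lambda>x. h x * exp (real k * x)) \<longlongrightarrow> C) at_top"
proof -
  obtain l c B where lG: "(G \<longlongrightarrow> l) at_top" and c: "0 < c" and B: "0 \<le> B"
    and tail: "\<And>x. 0 \<le> x \<Longrightarrow> l - G x \<le> B * exp (- c * x)"
    by (rule G_limit) blast
  have l: "l = 1" using tendsto_unique[OF _ lG G_tendsto_1] by simp
  define m where "m x = h x * exp (real k * x)" for x
  have m_pos: "0 < m x" for x using h_pos by (simp add: m_def)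
  have m_DERIV: "(m has_real_derivative real k * (1 - G z ^ (k - 1)) * m z) (at z)" if "0 < z" for z
    unfolding m_def using that by (auto intro!: derivative_eq_intros h_DERIV simp: algebra_simps)
  have m_cont: "continuous_on UNIV m"
    unfolding m_def by (intro continuous_intros h_continuous)
  have m_mono: "m x \<le> m y" if "0 \<le> x" "x \<le> y" for x y
  proof -
    have "- m y \<le> - m x"
    proof (rule nonincreasing_if_deriv_nonpos[where f = "\<lambda>z. - m z" and a = x and f' = "\<lambda>z. - (real k * (1 - G z ^ (k - 1)) * m z)"])
      show "- (real k * (1 - G z ^ (k - 1)) * m z) \<le> 0" for z
        using m_pos[of z] G_le_1[of z] G_nonneg[of z] by (simp add: power_le_one less_imp_le)
    qed (use that m_DERIV in \<open>auto intro!: continuous_intros DERIV_minus m_cont\<close>)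
    then show ?thesis by simp
  qed
  define E where "E = real k * real k * B / c"
  have "0 \<le> E" using B c by (simp add: E_def)
  have m_le: "m x \<le> m 0 * exp E" if "0 \<le> x" for x
  proof -
    \<comment> \<open>\<open>m\<close> times the exponential of the integrated bound on \<open>m'/m\<close> is nonincreasing\<close>
    let ?e = "\<lambda>x. exp (E * exp (- c * x))"
    have "m x * ?e x \<le> m 0 * ?e 0"
    proof (rule nonincreasing_if_deriv_nonpos[where f = "\<lambda>x. m x * ?e x" and a = 0
          and f' = "\<lambda>z. (real k * (1 - G z ^ (k - 1)) - E * c * exp (- c * z)) * (m z * ?e z)"])
      fix z :: real assume z: "0 < z"
      have "1 + real (k - 1) * (G z - 1) \<le> (1 + (G z - 1)) ^ (k - 1)"
        using G_nonneg[of z] by (intro Bernoulli_inequality) auto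
      then have "1 - G z ^ (k - 1) \<le> real (k - 1) * (1 - G z)" by (simp add: algebra_simps)
      also have "\<dots> \<le> real k * (B * exp (- c * z))"
        using tail[of z] z G_le_1[of z] by (intro mult_mono) (auto simp: l)
      finally have "real k * (1 - G z ^ (k - 1)) \<le> real k * (real k * (B * exp (- c * z)))"
        by (intro mult_left_mono) auto
      also have "\<dots> = E * c * exp (- c * z)" using c by (simp add: E_def)
      finally show "(real k * (1 - G z ^ (k - 1)) - E * c * exp (- c * z)) * (m z * ?e z) \<le> 0"
        using m_pos[of z] by (intro mult_nonpos_nonneg) auto
      show "((\<lambda>x. m x * ?e x) has_real_derivative
          (real k * (1 - G z ^ (k - 1)) - E * c * exp (- c * z)) * (m z * ?e z)) (at z)"
        using z by (auto intro!: derivative_eq_intros m_DERIV simp: algebra_simps)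
    qed (use that in \<open>auto intro!: continuous_intros m_cont\<close>)
    moreover have "m x * 1 \<le> m x * ?e x"
      using m_pos[of x] \<open>0 \<le> E\<close> by (intro mult_left_mono) auto
    ultimately show ?thesis by simp
  qed
  obtain C where "(m \<longlongrightarrow> C) at_top" "\<And>x. 0 \<le> x \<Longrightarrow> m x \<le> C"
    by (rule nondecreasing_bounded_tendsto[of m "m 0 * exp E"]) (auto intro: m_mono m_le)
  moreover from this(2)[of 0] m_pos[of 0] have "0 < C" by simp
  ultimately show thesis by (intro that[of C]) (simp_all add: m_def[abs_def])
qed

lemma deriv_G_asymptotics:
  "\<exists>C>0. deriv G \<sim>[at_top] (\<lambda>x. C * x * exp (- real k * x))"
proof -
  obtain C where C: "0 < C" "((\<lambda>x. h x * exp (real k * x)) \<longlongrightarrow> C) at_top" by (rule h_asymptotics)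
  have "((\<lambda>x. h x * exp (real k * x) / C) \<longlongrightarrow> C / C) at_top"
    using C by (intro tendsto_intros) auto
  moreover have "\<forall>\<^sub>F x in at_top. h x * exp (real k * x) / C = deriv G x / (C * x * exp (- real k * x))"
    using eventually_gt_at_top[of 0]
  proof eventually_elim
    case (elim x)
    then show ?case using C by (simp add: DERIV_imp_deriv[OF G_DERIV] exp_minus field_simps)
  qed
  ultimately have "((\<lambda>x. deriv G x / (C * x * exp (- real k * x))) \<longlongrightarrow> 1) at_top"
    using C by (simp add: tendsto_cong)
  then have "deriv G \<sim>[at_top] (\<lambda>x. C * x * exp (- real k * x))"
    by (rule asymp_equivI')
  then show ?thesis using C by blast
qed

end

section \<open>The profile is a steady state of the evolution equation\<close>

lemma fin_part_mono: "F \<in> D_set \<Longrightarrow> x \<le> y \<Longrightarrow> fin_part F x \<le> fin_part F y"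
  by (auto simp: D_set_def fin_part_def mono_def ennreal_leI)

lemma fin_part_bounds:
  assumes "F \<in> D_set"
  shows "0 \<le> fin_part F x" "fin_part F x \<le> 1"
  using assms by (auto simp: D_set_def fin_part_def image_subset_iff)

lemma fin_part_nonpos: "x \<le> 0 \<Longrightarrow> fin_part F x = fin_part F 0"
  by (simp add: fin_part_def ennreal_neg)

lemma fin_part_right_continuous:
  assumes "F \<in> D_set"
  shows "continuous (at_right a) (fin_part F)"
proof (cases "0 \<le> a")
  case True
  have "filterlim ennreal (at_right (ennreal a)) (at_right a)"
    unfolding filterlim_at
  proof
    show "(ennreal \<longlongrightarrow> ennreal a) (at_right a)" by (intro tendsto_intros)
    show "\<forall>\<^sub>F x in at_right a. ennreal x \<in> {ennreal a<..} \<and> ennreal x \<noteq> ennreal a"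
      using eventually_at_right_less[of a]
      by eventually_elim (use True in \<open>auto simp: ennreal_less_iff\<close>)
  qed
  moreover have "(F \<longlongrightarrow> F (ennreal a)) (at_right (ennreal a))"
    using assms by (auto simp: D_set_def cadlag_def continuous_within)
  ultimately show ?thesis
    unfolding continuous_within fin_part_def by (rule filterlim_compose[rotated])
next
  case False
  then have "\<forall>\<^sub>F x in at_right a. fin_part F x = fin_part F a"
    using fin_part_nonpos[of _ F] by (intro eventually_at_rightI[of a 0]) (metis greaterThanLessThan_iff less_imp_le not_le, simp)
  then show ?thesis
    unfolding continuous_within by (rule tendsto_eventually)
qed

lemma nn_integral_inverse_square:
  fixes z :: real
  assumes "0 < z"
  shows "(\<integral>\<^sup>+w. ennreal (1 / w\<^sup>2) * indicator {z..} w \<partial>lborel) = ennreal (1 / z)"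
proof -
  have "(\<integral>\<^sup>+w. ennreal (1 / w\<^sup>2) * indicator {z..} w \<partial>lborel) = ennreal (0 - (- 1 / z))"
  proof (rule nn_integral_FTC_atLeast)
    show "((\<lambda>w. - 1 / w) has_real_derivative 1 / x\<^sup>2) (at x)" if "z \<le> x" for x
      using that assms by (auto intro!: derivative_eq_intros simp: power2_eq_square)
    show "((\<lambda>w::real. - 1 / w) \<longlongrightarrow> 0) at_top" by real_asymp
  qed auto
  then show ?thesis by simp
qed

text \<open>
  Integration by parts, obtained from Tonelli's theorem by writing \<open>1/z\<close> as the integral of
  \<open>1/w\<^sup>2\<close> over \<open>w \<ge> z\<close>.  It turns the Stieltjes integrals of the evolution equation into
  Lebesgue integrals.
\<close>

lemma integral_inverse_interval_measure:
  fixes P :: "real \<Rightarrow> real"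
  assumes mono: "\<And>x y. x \<le> y \<Longrightarrow> P x \<le> P y" and rc: "\<And>a. continuous (at_right a) P" and y: "0 < y"
  shows "(LINT z:{y<..}|interval_measure P. 1 / z) = (LINT w:{y<..}|lborel. (P w - P y) / w\<^sup>2)"
proof -
  let ?M = "interval_measure P"
  interpret M: sigma_finite_measure ?M by (rule sigma_finite_interval_measure[OF mono rc])
  interpret pair_sigma_finite ?M lborel ..
  have P_meas[measurable]: "P \<in> borel_measurable borel"
    by (intro borel_measurable_mono) (auto simp: mono_def mono)
  have "(\<integral>\<^sup>+z. ennreal (indicator {y<..} z * (1 / z)) \<partial>?M)
      = (\<integral>\<^sup>+z. (\<integral>\<^sup>+w. ennreal (1 / w\<^sup>2) * indicator {y<..} z * indicator {z..} w \<partial>lborel) \<partial>?M)"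
  proof (rule nn_integral_cong)
    fix z
    show "ennreal (indicator {y<..} z * (1 / z))
        = (\<integral>\<^sup>+w. ennreal (1 / w\<^sup>2) * indicator {y<..} z * indicator {z..} w \<partial>lborel)"
      using nn_integral_inverse_square[of z] y by (cases "y < z") auto
  qed
  also have "\<dots> = (\<integral>\<^sup>+z. (\<integral>\<^sup>+w. ennreal (1 / w\<^sup>2) * indicator {p. y < fst p \<and> fst p \<le> snd p} (z, w) \<partial>lborel) \<partial>?M)"
    by (intro nn_integral_cong) (auto simp: indicator_def)
  also have "\<dots> = (\<integral>\<^sup>+w. (\<integral>\<^sup>+z. ennreal (1 / w\<^sup>2) * indicator {p. y < fst p \<and> fst p \<le> snd p} (z, w) \<partial>?M) \<partial>lborel)"
    by (rule Fubini'[symmetric]) measurable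
  also have "\<dots> = (\<integral>\<^sup>+w. ennreal (indicator {y<..} w * ((P w - P y) / w\<^sup>2)) \<partial>lborel)"
  proof (rule nn_integral_cong)
    fix w
    have "(\<integral>\<^sup>+z. ennreal (1 / w\<^sup>2) * indicator {p. y < fst p \<and> fst p \<le> snd p} (z, w) \<partial>?M)
        = (\<integral>\<^sup>+z. ennreal (1 / w\<^sup>2) * indicator {y<..w} z \<partial>?M)"
      by (intro nn_integral_cong) (auto simp: indicator_def)
    also have "\<dots> = ennreal (1 / w\<^sup>2) * emeasure ?M {y<..w}"
      by (subst nn_integral_cmult_indicator) auto
    also have "\<dots> = ennreal (indicator {y<..} w * ((P w - P y) / w\<^sup>2))"
      using mono[of y w] by (auto simp: emeasure_interval_measure_Ioc_eq[OF mono rc] indicator_def simp flip: ennreal_mult)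
    finally show "(\<integral>\<^sup>+z. ennreal (1 / w\<^sup>2) * indicator {p. y < fst p \<and> fst p \<le> snd p} (z, w) \<partial>?M)
        = ennreal (indicator {y<..} w * ((P w - P y) / w\<^sup>2))" .
  qed
  finally have eq: "(\<integral>\<^sup>+z. ennreal (indicator {y<..} z * (1 / z)) \<partial>?M)
      = (\<integral>\<^sup>+w. ennreal (indicator {y<..} w * ((P w - P y) / w\<^sup>2)) \<partial>lborel)" .
  have "(LINT z:{y<..}|?M. 1 / z) = enn2real (\<integral>\<^sup>+z. ennreal (indicator {y<..} z * (1 / z)) \<partial>?M)"
    unfolding set_lebesgue_integral_def real_scaleR_def
    using y by (intro integral_eq_nn_integral) (auto simp: indicator_def)
  also have "\<dots> = (LINT w:{y<..}|lborel. (P w - P y) / w\<^sup>2)"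
    unfolding set_lebesgue_integral_def real_scaleR_def eq
    using y mono[of y] by (intro integral_eq_nn_integral[symmetric]) (auto simp: indicator_def)
  finally show ?thesis .
qed

lemma nn_integral_Ioi_le:
  fixes f :: "real \<Rightarrow> ennreal"
  assumes [measurable]: "f \<in> borel_measurable borel"
    and le: "\<And>a. 0 < a \<Longrightarrow> (\<integral>\<^sup>+x. f x * indicator {a..} x \<partial>lborel) \<le> c"
  shows "(\<integral>\<^sup>+x. f x * indicator {0<..} x \<partial>lborel) \<le> c"
proof -
  let ?A = "\<lambda>n. {1 / real (Suc n)..}"
  have UN: "(\<Union>n. ?A n) = {0<..}"
  proof (safe; simp)
    fix x :: real assume "0 < x"
    then obtain n where "1 / real (Suc n) < x" using nat_approx_posE by blast
    then show "\<exists>n. 1 / (1 + real n) \<le> x" by (auto intro: less_imp_le)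
  next
    fix x :: real and n :: nat assume "1 / (1 + real n) \<le> x"
    then show "0 < x" by (rule less_le_trans[rotated]) simp
  qed
  have "(\<integral>\<^sup>+x. f x * indicator {0<..} x \<partial>lborel) = emeasure (density lborel f) (\<Union>n. ?A n)"
    by (simp add: emeasure_density UN del: UN_simps of_nat_Suc)
  also have "\<dots> = (SUP n. emeasure (density lborel f) (?A n))"
  proof (rule SUP_emeasure_incseq[symmetric])
    show "incseq ?A" unfolding incseq_def by (auto intro: order_trans[rotated] simp: frac_le)
  qed auto
  also have "\<dots> \<le> c"
    by (rule SUP_least) (auto simp: emeasure_density intro!: le)
  finally show ?thesis .
qed

lemma D_set_L1loc: "F \<in> D_set \<Longrightarrow> fin_part F \<in> L1loc"
  unfolding L1loc_def set_integrable_def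
proof (intro CollectI allI)
  fix N assume F: "F \<in> D_set"
  have [measurable]: "fin_part F \<in> borel_measurable borel"
    by (intro borel_measurable_mono) (auto simp: mono_def fin_part_mono[OF F])
  show "integrable lborel (\<lambda>x. indicator {0..N} x *\<^sub>R fin_part F x)"
  proof (rule integrableI_bounded_set[where A = "{0..N}" and B = 1])
    show "AE x in lborel. x \<in> {0..N} \<longrightarrow> norm (indicator {0..N} x *\<^sub>R fin_part F x) \<le> 1"
      using fin_part_bounds[OF F] by (auto simp: indicator_def)
  qed (auto simp: emeasure_lborel_Icc_eq)
qed

lemma topspace_L1loc: "topspace L1loc_topology \<subseteq> L1loc"
  unfolding L1loc_topology_def topology_generated_by_topspace by (auto simp: L1loc_ball_def)

lemma L1loc_opens_Pow: "{U. openin L1loc_topology U} \<subseteq> Pow L1loc"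
  using subset_trans[OF openin_subset topspace_L1loc] by auto

lemma space_L1loc_borel: "space L1loc_borel = L1loc"
  unfolding L1loc_borel_def by (rule space_measure_of[OF L1loc_opens_Pow])

context unit_profile
begin

text \<open>
  The profile as a function on \<open>[0,\<infinity>]\<close>; the value at \<open>top\<close> makes it a distribution function.
\<close>

definition steady :: "ennreal \<Rightarrow> real" where
  "steady x = (if x = top then 1 else G (enn2real x))"

lemma fin_part_steady: "fin_part steady = G"
proof
  show "fin_part steady x = G x" for x
    by (cases "0 \<le> x") (auto simp: fin_part_def steady_def G_nonpos ennreal_neg)
qed

lemma steady_mono: "mono steady"
proof (rule monoI)
  fix x y :: ennreal assume "x \<le> y"
  then show "steady x \<le> steady y"
    by (auto simp: steady_def G_le_1 top_unique less_top intro!: G_mono enn2real_mono)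
qed

lemma steady_continuous: "isCont steady x"
proof (cases "x = top")
  case True
  have "(steady \<longlongrightarrow> 1) (at_left top)"
  proof (rule order_tendstoI)
    fix a :: real assume "a < 1"
    then have "\<forall>\<^sub>F y in at_top. a < G y \<and> 0 \<le> y"
      using order_tendstoD(1)[OF G_tendsto_1] eventually_ge_at_top[of 0] by (intro eventually_conj) auto
    then obtain N where N: "a < G N" "0 \<le> N" 
      using eventually_happens'[OF trivial_limit_at_top_linorder] by blast
    show "\<forall>\<^sub>F y in at_left top. a < steady y"
    proof (rule eventually_at_leftI[of "ennreal N"])
      fix y assume "y \<in> {ennreal N<..<top}"
      then have "steady (ennreal N) \<le> steady y" by (intro monoD[OF steady_mono]) auto
      then show "a < steady y" using N by (simp add: steady_def)
    qed simp
  next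
    fix a :: real assume "1 < a"
    then show "\<forall>\<^sub>F y in at_left top. steady y < a"
      by (intro always_eventually allI) (auto simp: steady_def intro: le_less_trans[OF G_le_1])
  qed
  moreover have "at (top :: ennreal) = at_left top"
    by (rule filter_eqI) (simp add: eventually_at_filter less_top)
  ultimately show ?thesis using True by (simp add: continuous_within steady_def)
next
  case False
  have "(enn2real \<longlongrightarrow> enn2real x) (at x)"
    using False by (intro tendsto_enn2real) (auto simp: less_top)
  moreover have "isCont G (enn2real x)" using G_continuous by (simp add: continuous_on_eq_continuous_at)
  ultimately have "((\<lambda>x. G (enn2real x)) \<longlongrightarrow> G (enn2real x)) (at x)"
    by (rule isCont_tendsto_compose[rotated])
  moreover have "\<forall>\<^sub>F y in at x. G (enn2real y) = steady y"
  proof -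
    have "\<forall>\<^sub>F y in at x. y < top"
      using False by (intro order_tendstoD(2)[OF tendsto_ident_at]) (simp add: less_top)
    then show ?thesis by eventually_elim (auto simp: steady_def)
  qed
  ultimately have "(steady \<longlongrightarrow> G (enn2real x)) (at x)" by (rule Lim_transform_eventually)
  then show ?thesis using False by (simp add: continuous_within steady_def)
qed

lemma steady_in_D_set: "steady \<in> D_set"
proof -
  have "cadlag steady"
    unfolding cadlag_def
  proof (intro allI conjI exI)
    show "continuous (at_right x) steady" for x
      by (rule continuous_at_imp_continuous_at_within[OF steady_continuous])
    show "(steady \<longlongrightarrow> steady x) (at_left x)" for x
      using continuous_at_imp_continuous_at_within[OF steady_continuous, of x "{..<x}"]
      by (simp add: continuous_within)
  qed
  then show ?thesis
    using steady_mono G_nonneg G_le_1 by (auto simp: D_set_def steady_def)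
qed

lemma G_borel [measurable]: "G \<in> borel_measurable borel"
  by (rule borel_measurable_continuous_onI[OF G_continuous])

text \<open>
  The function \<open>F = - G/x + G\<^sup>k + x h\<close> is an antiderivative of \<open>G/x\<^sup>2\<close> that tends to \<open>1\<close> at infinity.
  It is nonnegative, as \<open>x F\<close> is nondecreasing and vanishes at \<open>0\<close>.
\<close>

lemma norm_G_le_1: "norm_xm2 G \<le> 1"
proof -
  have "(\<integral>\<^sup>+x. ennreal (\<bar>G x\<bar> / x\<^sup>2) * indicator {0<..} x \<partial>lborel) \<le> 1"
  proof (rule nn_integral_Ioi_le)
    fix a :: real assume a: "0 < a"
    let ?F = "\<lambda>x. - (G x / x) + G x ^ k + x * h x"
    have "(\<integral>\<^sup>+x. ennreal (\<bar>G x\<bar> / x\<^sup>2) * indicator {a..} x \<partial>lborel) = ennreal (1 - ?F a)"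
    proof (rule nn_integral_FTC_atLeast)
      fix x assume x: "a \<le> x"
      show "(?F has_real_derivative (\<bar>G x\<bar> / x\<^sup>2)) (at x)"
      proof (rule DERIV_cong)
        show "(?F has_real_derivative
            - ((x * h x * x - G x * 1) / (x * x)) + real k * (x * h x * G x ^ (k - Suc 0))
            + (1 * h x + - (real k * G x ^ (k - 1) * h x) * x)) (at x)"
          by (intro DERIV_add DERIV_minus DERIV_divide DERIV_power DERIV_mult DERIV_ident G_DERIV h_DERIV)
            (use x a in auto)
        have "(x * h x * x - G x) / (x * x) = h x - G x / x\<^sup>2"
          using x a by (simp add: diff_divide_distrib power2_eq_square)
        then show "- ((x * h x * x - G x * 1) / (x * x)) + real k * (x * h x * G x ^ (k - Suc 0))
            + (1 * h x + - (real k * G x ^ (k - 1) * h x) * x) = \<bar>G x\<bar> / x\<^sup>2"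
          using G_nonneg[of x] by simp
      qed
    next
      have "((\<lambda>x. - (G x * (1 / x)) + G x ^ k + x * h x) \<longlongrightarrow> - (1 * 0) + 1 ^ k + 0) at_top"
        by (intro tendsto_intros G_tendsto_1 xh_tendsto_0) real_asymp
      then show "(?F \<longlongrightarrow> 1) at_top" by simp
    qed auto
    also have "\<dots> \<le> 1"
    proof -
      have "- (a * G a ^ k + a\<^sup>2 * h a - G a) \<le> - (0 * G 0 ^ k + 0\<^sup>2 * h 0 - G 0)"
      proof (rule nonincreasing_if_deriv_nonpos[where f = "\<lambda>x. - (x * G x ^ k + x\<^sup>2 * h x - G x)"
            and a = 0 and f' = "\<lambda>x. - (G x ^ k + x * h x)"])
        show "- (G z ^ k + z * h z) \<le> 0" if "0 < z" for z
          using that h_pos[of z] zero_le_power[OF G_nonneg, of z k] mult_pos_pos[of z "h z"] by linarith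
        show "((\<lambda>x. - (x * G x ^ k + x\<^sup>2 * h x - G x)) has_real_derivative - (G z ^ k + z * h z)) (at z)"
          if "0 < z" for z
          using that by (auto intro!: derivative_eq_intros G_DERIV h_DERIV simp: power2_eq_square algebra_simps)
      qed (use a in \<open>auto intro!: continuous_intros G_continuous h_continuous\<close>)
      then have "0 \<le> (a * G a ^ k + a\<^sup>2 * h a - G a) / a" using a by (simp add: G_nonpos)
      also have "\<dots> = ?F a" using a by (simp add: field_simps power2_eq_square)
      finally show ?thesis by (simp add: ennreal_le_1)
    qed
    finally show "(\<integral>\<^sup>+x. ennreal (\<bar>G x\<bar> / x\<^sup>2) * indicator {a..} x \<partial>lborel) \<le> 1" .
  qed measurable
  moreover have "norm_xm2 G = (\<integral>\<^sup>+x. ennreal (\<bar>G x\<bar> / x\<^sup>2) * indicator {0<..} x \<partial>lborel)"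
    unfolding norm_xm2_def by (intro nn_integral_cong) (auto simp: indicator_def)
  ultimately show ?thesis by simp
qed

lemma steady_in_D1_set: "steady \<in> D1_set"
  using steady_in_D_set norm_G_le_1 by (simp add: D1_set_def fin_part_steady)

text \<open>
  After integration by parts the integrand is \<open>(G(w)\<^sup>k - G(y)\<^sup>k) / w\<^sup>2\<close>, with the antiderivative
  \<open>- (G(w)\<^sup>k - G(y)\<^sup>k) / w - h(w)\<close>, which is \<open>- h(y)\<close> at \<open>w = y\<close> and \<open>0\<close> at infinity.
\<close>

lemma tail_integral_steady:
  assumes y: "0 < y"
  shows "tail_integral (\<lambda>u. u ^ k) steady y = h y"
proof -
  have mono: "G x ^ k \<le> G z ^ k" if "x \<le> z" for x z
    using that by (intro power_mono G_mono G_nonneg)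
  have cont: "continuous_on UNIV (\<lambda>z. G z ^ k)" by (intro continuous_intros G_continuous)
  have rc: "continuous (at_right a) (\<lambda>z. G z ^ k)" for a
    using cont by (auto simp: continuous_on_eq_continuous_at intro: continuous_at_imp_continuous_at_within)
  let ?f = "\<lambda>w. (G w ^ k - G y ^ k) / w\<^sup>2" and ?F = "\<lambda>w. - ((G w ^ k - G y ^ k) / w) - h w"
  have "tail_integral (\<lambda>u. u ^ k) steady y = (LINT w:{y<..}|lborel. ?f w)"
    unfolding tail_integral_def fin_part_steady
    by (rule integral_inverse_interval_measure[OF mono rc y])
  also have "\<dots> = enn2real (\<integral>\<^sup>+w. ennreal (indicator {y<..} w * ?f w) \<partial>lborel)"
    unfolding set_lebesgue_integral_def real_scaleR_def
    using mono[of y] by (intro integral_eq_nn_integral) (auto simp: indicator_def)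
  also have "(\<integral>\<^sup>+w. ennreal (indicator {y<..} w * ?f w) \<partial>lborel) = (\<integral>\<^sup>+w. ennreal (?f w) * indicator {y..} w \<partial>lborel)"
    by (intro nn_integral_cong) (auto simp: indicator_def)
  also have "\<dots> = ennreal (0 - ?F y)"
  proof (rule nn_integral_FTC_atLeast[where F = ?F and a = y])
    fix x assume x: "y \<le> x"
    show "(?F has_real_derivative ?f x) (at x)"
      using x y by (auto intro!: derivative_eq_intros G_DERIV h_DERIV simp: power2_eq_square field_simps)
    show "0 \<le> ?f x" using mono[OF x] by simp
  next
    have "((\<lambda>w. - ((G w ^ k - G y ^ k) * (1 / w)) - h w) \<longlongrightarrow> - ((1 ^ k - G y ^ k) * 0) - 0) at_top"
      by (intro tendsto_intros G_tendsto_1 h_tendsto_0) real_asymp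
    then show "(?F \<longlongrightarrow> 0) at_top" by simp
  qed measurable
  finally show ?thesis using h_pos[of y] by (simp add: less_imp_le)
qed

text \<open>
  Along \<open>s \<mapsto> exp(s - t) x\<close> the integrand of the evolution equation is the derivative of \<open>G\<close>,
  so the time integral telescopes.
\<close>

lemma S_op_steady:
  assumes t: "0 \<le> t" and x: "0 \<le> x"
  shows "S_op (\<lambda>u. u ^ k) (\<lambda>_. steady) t x = G x"
proof (cases "x = 0")
  case True
  then show ?thesis by (simp add: S_op_def fin_part_steady set_lebesgue_integral_def)
next
  case False
  with x have x: "0 < x" by simp
  let ?e = "\<lambda>s. exp (s - t) * x"
  have "(LINT s:{0..t}|lborel. (?e s)\<^sup>2 * tail_integral (\<lambda>u. u ^ k) steady (?e s))
      = (LINT s:{0..t}|lborel. (?e s)\<^sup>2 * h (?e s))"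
    using x by (simp add: tail_integral_steady)
  also have "\<dots> = G (?e t) - G (?e 0)"
    unfolding set_lebesgue_integral_def
  proof (rule integral_FTC_atLeastAtMost[OF t])
    fix s
    have "((\<lambda>s. G (?e s)) has_real_derivative (?e s * h (?e s)) * ?e s) (at s)"
      by (rule DERIV_chain2[OF G_DERIV]) (use x in \<open>auto intro!: derivative_eq_intros\<close>)
    then show "((\<lambda>s. G (?e s)) has_vector_derivative (?e s)\<^sup>2 * h (?e s)) (at s within {0..t})"
      by (auto simp: has_real_derivative_iff_has_vector_derivative[symmetric] power2_eq_square mult_ac
          intro: has_field_derivative_at_within)
  qed (auto intro!: continuous_intros continuous_on_compose2[OF h_continuous])
  finally show ?thesis by (simp add: S_op_def fin_part_steady)
qed

lemma G_at_bot: "(G \<longlongrightarrow> 0) at_bot"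
  by (rule tendsto_eventually, rule eventually_mono[OF eventually_le_at_bot[of 0]]) (rule G_nonpos)

lemma G_right_continuous: "continuous (at_right a) G"
  using G_continuous by (auto simp: continuous_on_eq_continuous_at intro: continuous_at_imp_continuous_at_within)

lemma steady_distribution_function: "distribution_function steady"
proof -
  let ?M = "interval_measure G"
  have cdf: "cdf ?M = G"
    by (rule cdf_interval_measure[OF G_mono G_right_continuous G_at_bot])
  interpret M: real_distribution ?M
    by (rule real_distribution_interval_measure[OF G_mono G_right_continuous G_at_bot G_tendsto_1])
  have "measure ?M {..<0} \<le> measure ?M {..0}"
    by (intro M.finite_measure_mono) auto
  also have "\<dots> = 0" using fun_cong[OF cdf, of 0] by (simp add: cdf_def G_nonpos)
  finally have "measure ?M {..<0} = 0" using measure_nonneg[of ?M "{..<0}"] by linarith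
  moreover have "steady (ennreal x) = cdf ?M x" if "0 \<le> x" for x
    using that by (simp add: cdf steady_def)
  ultimately show ?thesis
    unfolding distribution_function_def using M.real_distribution_axioms
    by (auto intro!: exI[of _ ?M] simp: steady_def)
qed

lemma steady_solution: "(\<lambda>_. steady) \<in> solutions (\<lambda>u. u ^ k)"
proof -
  have "tight_family (\<lambda>_. steady)"
    unfolding tight_family_def
  proof safe
    fix \<epsilon> :: real assume "0 < \<epsilon>"
    then have "\<forall>\<^sub>F x in at_top. 1 - \<epsilon> < G x \<and> 0 \<le> x"
      using order_tendstoD(1)[OF G_tendsto_1, of "1 - \<epsilon>"] eventually_ge_at_top[of 0]
      by (intro eventually_conj) auto
    then obtain N where "1 - \<epsilon> < G N" "0 \<le> N" 
      using eventually_happens'[OF trivial_limit_at_top_linorder] by blast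
    then show "\<exists>N\<ge>0. \<forall>t\<ge>0. 1 - \<epsilon> < steady (ennreal N)"
      by (intro exI[of _ N]) (auto simp: steady_def)
  qed
  moreover have "(\<lambda>t. fin_part steady) \<in> restrict_space borel {0..} \<rightarrow>\<^sub>M L1loc_borel"
    by (rule measurable_const) (simp add: space_L1loc_borel D_set_L1loc steady_in_D_set)
  moreover have "steady top = 1" by (simp add: steady_def)
  ultimately show ?thesis
    using steady_in_D_set steady_in_D1_set by (auto simp: solutions_def X1_set_def X_set_def S_op_steady fin_part_steady)
qed

end

section \<open>Measurability of families and a chain rule for absolute values\<close>

text \<open>
  A chain rule for \<open>\<bar>u\<bar>\<close> when \<open>u\<close> is the integral of a merely integrable function \<open>v\<close>, for which
  derivatives of \<open>u\<close> are known only almost everywhere.  On short intervals on which \<open>u\<close> has no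
  zero, the sign of \<open>u\<close> is constant and the claim is immediate; near a zero \<open>u\<close> is small and the
  assumption on small values applies, at the cost of \<open>\<eta>\<close> times the length of the interval.
  Bolzano's bisection principle glues the short intervals together.
\<close>

lemma abs_le_integral_of_rate:
  fixes u v r :: "real \<Rightarrow> real"
  assumes t: "0 \<le> t" and v: "v integrable_on {0..t}" and r: "r integrable_on {0..t}"
    and u: "\<And>s. 0 \<le> s \<Longrightarrow> s \<le> t \<Longrightarrow> u s = u 0 + integral {0..s} v"
    and pos: "\<And>s. 0 \<le> s \<Longrightarrow> s \<le> t \<Longrightarrow> 0 < u s \<Longrightarrow> v s \<le> r s"
    and neg: "\<And>s. 0 \<le> s \<Longrightarrow> s \<le> t \<Longrightarrow> u s < 0 \<Longrightarrow> - v s \<le> r s"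
    and small: "\<And>\<eta>. 0 < \<eta> \<Longrightarrow> \<exists>\<epsilon>>0. \<forall>s. 0 \<le> s \<and> s \<le> t \<and> \<bar>u s\<bar> < \<epsilon> \<longrightarrow> \<bar>v s\<bar> \<le> r s + \<eta>"
  shows "\<bar>u t\<bar> \<le> \<bar>u 0\<bar> + integral {0..t} r"
proof -
  have v_on: "v integrable_on {a..b}" and r_on: "r integrable_on {a..b}" if "0 \<le> a" "b \<le> t" for a b
    using that by (auto intro: integrable_on_subinterval[OF v] integrable_on_subinterval[OF r])
  have incr: "u b - u a = integral {a..b} v" if "0 \<le> a" "a \<le> b" "b \<le> t" for a b
  proof -
    have "integral {0..a} v + integral {a..b} v = integral {0..b} v"
      using that by (intro Henstock_Kurzweil_Integration.integral_combine v_on) auto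
    moreover have "u a = u 0 + integral {0..a} v" "u b = u 0 + integral {0..b} v"
      using that by (auto intro: u)
    ultimately show ?thesis by linarith
  qed
  have u_cont: "continuous_on {0..t} u"
  proof -
    have "continuous_on {0..t} (\<lambda>s. u 0 + integral {0..s} v)"
      by (intro continuous_intros indefinite_integral_continuous_1 v)
    then show ?thesis by (rule continuous_on_eq) (simp add: u[symmetric])
  qed
  have main: "\<bar>u t\<bar> \<le> \<bar>u 0\<bar> + integral {0..t} r + \<eta> * t" if \<eta>: "0 < \<eta>" for \<eta>
  proof -
    let ?P = "\<lambda>a b. 0 \<le> a \<and> a \<le> b \<and> b \<le> t \<longrightarrow> \<bar>u b\<bar> \<le> \<bar>u a\<bar> + integral {a..b} r + \<eta> * (b - a)"
    have "?P 0 t"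
    proof (rule Bolzano[of 0 t ?P, OF t])
      fix a b c assume P: "?P a b" "?P b c" and abc: "a \<le> b" "b \<le> c"
      show "?P a c"
      proof
        assume "0 \<le> a \<and> a \<le> c \<and> c \<le> t"
        then have "integral {a..b} r + integral {b..c} r = integral {a..c} r"
          using abc by (intro Henstock_Kurzweil_Integration.integral_combine r_on) auto
        with P abc \<open>0 \<le> a \<and> a \<le> c \<and> c \<le> t\<close> show "\<bar>u c\<bar> \<le> \<bar>u a\<bar> + integral {a..c} r + \<eta> * (c - a)"
          by (simp add: algebra_simps)
      qed
    next
      fix x assume x: "0 \<le> x" "x \<le> t"
      have near: "\<exists>d>0. \<forall>y\<in>{0..t}. \<bar>y - x\<bar> < d \<longrightarrow> \<bar>u y - u x\<bar> < e" if "0 < e" for e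
        using u_cont x that by (auto simp: continuous_on_iff dist_real_def)
      have bound: "\<bar>u b\<bar> \<le> \<bar>u a\<bar> + integral {a..b} r + \<eta> * (b - a)"
        if ab: "0 \<le> a" "a \<le> b" "b \<le> t"
          and cases: "(\<forall>s\<in>{a..b}. 0 < u s) \<or> (\<forall>s\<in>{a..b}. u s < 0) \<or> (\<forall>s\<in>{a..b}. \<bar>v s\<bar> \<le> r s + \<eta>)" for a b
      proof -
        have \<eta>ab: "0 \<le> \<eta> * (b - a)" using ab \<eta> by simp
        consider "\<forall>s\<in>{a..b}. 0 < u s" | "\<forall>s\<in>{a..b}. u s < 0" | "\<forall>s\<in>{a..b}. \<bar>v s\<bar> \<le> r s + \<eta>"
          using cases by blast
        then show ?thesis
        proof cases
          case 1
          have "integral {a..b} v \<le> integral {a..b} r"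
            using 1 ab by (intro integral_le v_on r_on) (auto intro!: pos)
          moreover have "0 < u a" "0 < u b" using 1 ab by auto
          ultimately show ?thesis using incr[OF ab] \<eta>ab by linarith
        next
          case 2
          have "integral {a..b} (\<lambda>s. - v s) \<le> integral {a..b} r"
            using 2 ab by (intro integral_le integrable_neg v_on r_on) (auto intro!: neg)
          moreover have "u a < 0" "u b < 0" using 2 ab by auto
          ultimately show ?thesis using incr[OF ab] \<eta>ab by simp
        next
          case 3
          have "norm (integral {a..b} v) \<le> integral {a..b} (\<lambda>s. r s + \<eta>)"
            using 3 ab by (intro integral_norm_bound_integral integrable_add v_on r_on integrable_const_ivl) auto
          also have "\<dots> = integral {a..b} r + \<eta> * (b - a)"
            using ab by (subst Henstock_Kurzweil_Integration.integral_add) (auto intro: r_on)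
          finally show ?thesis using incr[OF ab] by simp
        qed
      qed
      show "\<exists>d>0. \<forall>a b. a \<le> x \<and> x \<le> b \<and> b - a < d \<longrightarrow> ?P a b"
      proof (cases "u x = 0")
        case True
        obtain \<epsilon> where \<epsilon>: "0 < \<epsilon>" "\<And>s. 0 \<le> s \<Longrightarrow> s \<le> t \<Longrightarrow> \<bar>u s\<bar> < \<epsilon> \<Longrightarrow> \<bar>v s\<bar> \<le> r s + \<eta>"
          using small[OF \<eta>] by blast
        obtain d where "0 < d" "\<And>y. y \<in> {0..t} \<Longrightarrow> \<bar>y - x\<bar> < d \<Longrightarrow> \<bar>u y - u x\<bar> < \<epsilon>"
          using near[OF \<epsilon>(1)] by blast
        then show ?thesis
          using True by (intro exI[of _ d] conjI allI impI bound disjI2 ballI \<epsilon>(2)) fastforce+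
      next
        case False
        obtain d where d: "0 < d" "\<And>y. y \<in> {0..t} \<Longrightarrow> \<bar>y - x\<bar> < d \<Longrightarrow> \<bar>u y - u x\<bar> < \<bar>u x\<bar>"
          using near[of "\<bar>u x\<bar>"] False by auto
        show ?thesis
        proof (intro exI[of _ d] conjI allI impI d(1))
          fix a b assume *: "a \<le> x \<and> x \<le> b \<and> b - a < d" "0 \<le> a \<and> a \<le> b \<and> b \<le> t"
          have "\<bar>u s - u x\<bar> < \<bar>u x\<bar>" if "s \<in> {a..b}" for s
            using that * by (intro d(2)) auto
          then have "(\<forall>s\<in>{a..b}. 0 < u s) \<or> (\<forall>s\<in>{a..b}. u s < 0)"
            by (cases "0 < u x") (force simp: abs_less_iff)+
          then show "\<bar>u b\<bar> \<le> \<bar>u a\<bar> + integral {a..b} r + \<eta> * (b - a)"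
            using * by (intro bound) auto
        qed
      qed
    qed
    then show ?thesis using t by simp
  qed
  show ?thesis
  proof (rule field_le_epsilon)
    fix e :: real assume e: "0 < e"
    have "e / (t + 1) * t \<le> e" using e t by (simp add: field_simps)
    with main[of "e / (t + 1)"] e t show "\<bar>u t\<bar> \<le> \<bar>u 0\<bar> + integral {0..t} r + e" by simp
  qed
qed

text \<open>
  Integration over an interval is continuous on \<open>L1loc\<close>, since the integral of \<open>f - g\<close> over \<open>[a, b]\<close>
  is at most that of \<open>\<bar>f - g\<bar>\<close> over \<open>[0, b]\<close>.  Measurable families can thus be evaluated on short
  intervals, and in the limit at points.
\<close>

lemma openin_integral_less:
  assumes a: "0 \<le> a"
  shows "openin L1loc_topology {g \<in> L1loc. (LINT x:{a..b}|lborel. g x) < c}"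
proof (subst openin_subopen, intro ballI)
  fix g assume g: "g \<in> {g \<in> L1loc. (LINT x:{a..b}|lborel. g x) < c}"
  define \<epsilon> where "\<epsilon> = c - (LINT x:{a..b}|lborel. g x)"
  have \<epsilon>: "0 < \<epsilon>" using g by (simp add: \<epsilon>_def)
  have int: "set_integrable lborel {0..N} f" if "f \<in> L1loc" for f N using that by (simp add: L1loc_def)
  have "L1loc_ball g b \<epsilon> \<subseteq> {g \<in> L1loc. (LINT x:{a..b}|lborel. g x) < c}"
  proof
    fix f assume "f \<in> L1loc_ball g b \<epsilon>"
    then have f: "f \<in> L1loc" "(LINT x:{0..b}|lborel. \<bar>f x - g x\<bar>) < \<epsilon>" by (auto simp: L1loc_ball_def)
    have int0: "set_integrable lborel {0..b} (\<lambda>x. \<bar>f x - g x\<bar>)"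
      using f g by (intro set_integrable_abs set_integral_diff int) auto
    have inta: "set_integrable lborel {a..b} f'" if "f' \<in> L1loc" for f'
      by (rule set_integrable_subset[OF int[OF that, of b]]) (use a in auto)
    have "(LINT x:{a..b}|lborel. f x) - (LINT x:{a..b}|lborel. g x) = (LINT x:{a..b}|lborel. f x - g x)"
      using f g by (subst set_integral_diff) (auto intro: inta)
    also have "\<dots> \<le> (LINT x:{0..b}|lborel. \<bar>f x - g x\<bar>)"
      unfolding set_lebesgue_integral_def
    proof (rule integral_mono)
      show "integrable lborel (\<lambda>x. indicator {a..b} x *\<^sub>R (f x - g x))"
        using set_integral_diff(1)[OF inta inta, of f g] f g by (simp add: set_integrable_def)
      show "integrable lborel (\<lambda>x. indicator {0..b} x *\<^sub>R \<bar>f x - g x\<bar>)"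
        using int0 by (simp add: set_integrable_def)
    qed (use a in \<open>auto simp: indicator_def\<close>)
    also have "\<dots> < \<epsilon>" by (rule f)
    finally show "f \<in> {g \<in> L1loc. (LINT x:{a..b}|lborel. g x) < c}" using f by (simp add: \<epsilon>_def)
  qed
  moreover have "openin L1loc_topology (L1loc_ball g b \<epsilon>)"
    unfolding L1loc_topology_def using g \<epsilon> by (intro topology_generated_by_Basis) auto
  moreover have "g \<in> L1loc_ball g b \<epsilon>" using g \<epsilon> by (simp add: L1loc_ball_def)
  ultimately show "\<exists>T. openin L1loc_topology T \<and> g \<in> T \<and> T \<subseteq> {g \<in> L1loc. (LINT x:{a..b}|lborel. g x) < c}"
    by blast
qed

lemma borel_measurable_integral_L1loc:
  assumes "0 \<le> a"
  shows "(\<lambda>g. LINT x:{a..b}|lborel. g x) \<in> borel_measurable L1loc_borel"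
  unfolding borel_measurable_iff_less space_L1loc_borel
proof
  fix c
  show "{w \<in> L1loc. (LINT x:{a..b}|lborel. w x) < c} \<in> sets L1loc_borel"
    unfolding L1loc_borel_def sets_measure_of[OF L1loc_opens_Pow]
    using openin_integral_less[OF assms] by (intro sigma_sets.Basic) auto
qed

text \<open>
  Families are only constrained at times \<open>t \<ge> 0\<close>.  Clamping the time at \<open>0\<close> gives a function that is
  measurable on the whole plane.
\<close>

definition slice :: "(real \<Rightarrow> ennreal \<Rightarrow> real) \<Rightarrow> real \<Rightarrow> real \<Rightarrow> real" where
  "slice F s x = fin_part (F (max 0 s)) x"

lemma X_set_D: "F \<in> X_set \<Longrightarrow> F (max 0 s) \<in> D_set"
  by (simp add: X_set_def)

lemma slice_mono: "F \<in> X_set \<Longrightarrow> x \<le> y \<Longrightarrow> slice F s x \<le> slice F s y"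
  unfolding slice_def by (intro fin_part_mono X_set_D)

lemma slice_bounds: "F \<in> X_set \<Longrightarrow> 0 \<le> slice F s x" "F \<in> X_set \<Longrightarrow> slice F s x \<le> 1"
  unfolding slice_def by (intro fin_part_bounds X_set_D; assumption)+

lemma slice_right_continuous: "F \<in> X_set \<Longrightarrow> continuous (at_right a) (slice F s)"
  unfolding slice_def by (rule fin_part_right_continuous[OF X_set_D])

lemma tendsto_slice_from_right:
  assumes F: "F \<in> X_set" and X: "X \<longlonglongrightarrow> x" "\<And>n. x < X n"
  shows "(\<lambda>n. slice F s (X n)) \<longlonglongrightarrow> slice F s x"
proof -
  have "(slice F s \<longlongrightarrow> slice F s x) (at_right x)"
    using slice_right_continuous[OF F] by (simp add: continuous_within)
  moreover have "filterlim X (at_right x) sequentially"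
    unfolding filterlim_at using X by (auto simp: less_imp_neq[symmetric] intro: always_eventually)
  ultimately show ?thesis by (rule filterlim_compose)
qed

text \<open>
  By right-continuity the value at \<open>x\<close> is the limit of the averages over \<open>[x, x + 1/n]\<close>, which are
  measurable in time.
\<close>

lemma borel_measurable_slice_time:
  assumes F: "F \<in> X_set"
  shows "(\<lambda>s. slice F s x) \<in> borel_measurable borel"
proof -
  have pos: "(\<lambda>s. slice F s x) \<in> borel_measurable borel" if x: "0 \<le> x" for x
  proof (rule borel_measurable_LIMSEQ_real)
    let ?d = "\<lambda>n. 1 / real (Suc n)"
    let ?avg = "\<lambda>n s. real (Suc n) * (LINT z:{x..x + ?d n}|lborel. slice F s z)"
    show "?avg n \<in> borel_measurable borel" for n
    proof -
      have "(\<lambda>s. max 0 s) \<in> borel \<rightarrow>\<^sub>M restrict_space borel {0::real..}"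
        by (intro measurable_restrict_space2) auto
      moreover have "(\<lambda>t. fin_part (F t)) \<in> restrict_space borel {0..} \<rightarrow>\<^sub>M L1loc_borel"
        using F by (simp add: X_set_def)
      ultimately have "(\<lambda>s. slice F s) \<in> borel \<rightarrow>\<^sub>M L1loc_borel"
        unfolding slice_def by (rule measurable_compose)
      from measurable_compose[OF this borel_measurable_integral_L1loc[OF x]]
      show ?thesis by (intro borel_measurable_times) auto
    qed
    fix s
    have int: "set_integrable lborel {x..x + ?d n} (slice F s)" for n
    proof -
      have "slice F s \<in> L1loc" unfolding slice_def by (rule D_set_L1loc[OF X_set_D[OF F]])
      then have "set_integrable lborel {0..x + ?d n} (slice F s)" by (simp add: L1loc_def)
      then show ?thesis by (rule set_integrable_subset) (use x in auto)
    qed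
    have intc: "set_integrable lborel {x..x + ?d n} (\<lambda>_. c)" for n and c :: real
      by (simp add: set_integrable_def)
    have const: "(LINT z:{x..x + ?d n}|lborel. c) = c / real (Suc n)" for n c
      by (simp add: set_lebesgue_integral_def)
    show "(\<lambda>n. ?avg n s) \<longlonglongrightarrow> slice F s x"
    proof (rule tendsto_sandwich[OF _ _ tendsto_const])
      show "(\<lambda>n. slice F s (x + ?d n)) \<longlonglongrightarrow> slice F s x"
      proof (rule tendsto_slice_from_right[OF F])
        have "(\<lambda>n. x + ?d n) \<longlonglongrightarrow> x + 0"
          by (intro tendsto_intros LIMSEQ_Suc[OF lim_1_over_n])
        then show "(\<lambda>n. x + ?d n) \<longlonglongrightarrow> x" by simp
      qed simp
      have "slice F s x \<le> ?avg n s" for n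
      proof -
        have "(LINT z:{x..x + ?d n}|lborel. slice F s x) \<le> (LINT z:{x..x + ?d n}|lborel. slice F s z)"
          by (intro set_integral_mono int intc slice_mono[OF F]) auto
        then have "slice F s x / real (Suc n) \<le> (LINT z:{x..x + ?d n}|lborel. slice F s z)"
          by (simp only: const)
        then show ?thesis by (simp add: pos_divide_le_eq mult.commute del: of_nat_Suc)
      qed
      then show "\<forall>\<^sub>F n in sequentially. slice F s x \<le> ?avg n s" by simp
      have "?avg n s \<le> slice F s (x + ?d n)" for n
      proof -
        have "(LINT z:{x..x + ?d n}|lborel. slice F s z) \<le> (LINT z:{x..x + ?d n}|lborel. slice F s (x + ?d n))"
          by (intro set_integral_mono int intc slice_mono[OF F]) auto
        then have "(LINT z:{x..x + ?d n}|lborel. slice F s z) \<le> slice F s (x + ?d n) / real (Suc n)"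
          by (simp only: const)
        then show ?thesis by (simp add: pos_le_divide_eq mult.commute del: of_nat_Suc)
      qed
      then show "\<forall>\<^sub>F n in sequentially. ?avg n s \<le> slice F s (x + ?d n)" by simp
    qed
  qed
  show ?thesis
    using pos[of x] pos[of 0] fin_part_nonpos[of x] by (cases "0 \<le> x") (auto simp: slice_def)
qed

text \<open>
  Joint measurability in time and space: approximate the space variable from the right by the
  multiples of \<open>1/n\<close>, of which there are only countably many.
\<close>

lemma borel_measurable_slice [measurable (raw)]:
  assumes F: "F \<in> X_set" and [measurable]: "g \<in> borel_measurable M" "h \<in> borel_measurable M"
  shows "(\<lambda>w. slice F (g w) (h w)) \<in> borel_measurable M"
proof (rule borel_measurable_LIMSEQ_real)
  let ?r = "\<lambda>n w. (\<lfloor>h w * real (Suc n)\<rfloor> + 1) / real (Suc n)"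
  show "(\<lambda>n. slice F (g w) (?r n w)) \<longlonglongrightarrow> slice F (g w) (h w)" for w
  proof (rule tendsto_slice_from_right[OF F])
    have bounds: "h w < ?r n w" "?r n w \<le> h w + 1 / real (Suc n)" for n
      by (simp_all add: field_simps del: of_nat_Suc) linarith+
    then show "h w < ?r n w" for n by simp
    have "(\<lambda>n. h w + 1 / real (Suc n)) \<longlonglongrightarrow> h w + 0"
      by (intro tendsto_intros LIMSEQ_Suc[OF lim_1_over_n])
    then have lim: "(\<lambda>n. h w + 1 / real (Suc n)) \<longlonglongrightarrow> h w" by simp
    show "(\<lambda>n. ?r n w) \<longlonglongrightarrow> h w"
      by (rule tendsto_sandwich[OF _ _ tendsto_const lim]; intro always_eventually allI)
        (rule less_imp_le[OF bounds(1)], rule bounds(2))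
  qed
  show "(\<lambda>w. slice F (g w) (?r n w)) \<in> borel_measurable M" for n
  proof (rule measurable_compose_countable[where g = "\<lambda>w. \<lfloor>h w * real (Suc n)\<rfloor>"
        and f = "\<lambda>i w. slice F (g w) (real_of_int (i + 1) / real (Suc n))"])
    show "(\<lambda>w. slice F (g w) (real_of_int (i + 1) / real (Suc n))) \<in> borel_measurable M" for i
      by (rule measurable_compose[OF _ borel_measurable_slice_time[OF F]]) measurable
  qed measurable
qed

section \<open>Solutions along characteristics\<close>

lemma inverse_square_tail:
  fixes x :: real
  assumes x: "0 < x"
  shows "set_integrable lborel {x<..} (\<lambda>z. 1 / z\<^sup>2)" "(LINT z:{x<..}|lborel. 1 / z\<^sup>2) = 1 / x"
proof -
  have "(\<integral>\<^sup>+z. ennreal (indicator {x<..} z * (1 / z\<^sup>2)) \<partial>lborel) = (\<integral>\<^sup>+z. ennreal (1 / z\<^sup>2) * indicator {x..} z \<partial>lborel)"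
    by (intro nn_integral_cong_AE AE_I[where N = "{x}"]) (auto simp: indicator_def)
  also have "\<dots> = ennreal (1 / x)" by (rule nn_integral_inverse_square[OF x])
  finally have "has_bochner_integral lborel (\<lambda>z. indicator {x<..} z * (1 / z\<^sup>2)) (1 / x)"
    using x by (intro has_bochner_integral_nn_integral) (auto simp: indicator_def)
  then show "set_integrable lborel {x<..} (\<lambda>z. 1 / z\<^sup>2)" "(LINT z:{x<..}|lborel. 1 / z\<^sup>2) = 1 / x"
    by (auto simp: set_integrable_def set_lebesgue_integral_def has_bochner_integral_iff)
qed

lemma set_integrable_div_square:
  fixes g :: "real \<Rightarrow> real"
  assumes [measurable]: "g \<in> borel_measurable borel" and g: "\<And>z. \<bar>g z\<bar> \<le> 1" and x: "0 < x"
  shows "set_integrable lborel {x<..} (\<lambda>z. g z / z\<^sup>2)"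
proof (rule set_integrable_bound[OF inverse_square_tail(1)[OF x]])
  show "set_borel_measurable lborel {x<..} (\<lambda>z. g z / z\<^sup>2)"
    unfolding set_borel_measurable_def by measurable
  show "AE z in lborel. z \<in> {x<..} \<longrightarrow> norm (g z / z\<^sup>2) \<le> norm (1 / z\<^sup>2)"
    using g by (auto simp: divide_right_mono)
qed

lemma set_nn_integral_eq_set_integral:
  fixes g :: "real \<Rightarrow> real"
  assumes "set_integrable lborel A g" "\<And>x. x \<in> A \<Longrightarrow> 0 \<le> g x"
  shows "(\<integral>\<^sup>+x\<in>A. ennreal (g x) \<partial>lborel) = ennreal (LINT x:A|lborel. g x)"
proof -
  have "(\<integral>\<^sup>+x\<in>A. ennreal (g x) \<partial>lborel) = (\<integral>\<^sup>+x. ennreal (indicator A x *\<^sub>R g x) \<partial>lborel)"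
    by (intro nn_integral_cong) (auto simp: indicator_def)
  also have "\<dots> = ennreal (LINT x:A|lborel. g x)"
    unfolding set_lebesgue_integral_def
    using assms by (intro nn_integral_eq_integral) (auto simp: set_integrable_def indicator_def)
  finally show ?thesis .
qed

text \<open>
  Monotonicity of \<open>\<Psi>\<close> gives the loss term its sign.  The Lipschitz bound makes the loss integrable near
  \<open>0\<close>, where only the norm of the solutions with weight \<open>1/x\<^sup>2\<close> is controlled, and it carries the
  tightness of the solutions over to their images under \<open>\<Psi>\<close>.
\<close>

locale choice_function =
  fixes \<Psi> :: "real \<Rightarrow> real" and L :: real
  assumes \<Psi>_mono: "0 \<le> a \<Longrightarrow> a \<le> b \<Longrightarrow> b \<le> 1 \<Longrightarrow> \<Psi> a \<le> \<Psi> b"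
    and \<Psi>_Lipschitz: "0 \<le> a \<Longrightarrow> a \<le> 1 \<Longrightarrow> 0 \<le> b \<Longrightarrow> b \<le> 1 \<Longrightarrow> \<bar>\<Psi> a - \<Psi> b\<bar> \<le> L * \<bar>a - b\<bar>"
    and \<Psi>_bounds: "0 \<le> a \<Longrightarrow> a \<le> 1 \<Longrightarrow> 0 \<le> \<Psi> a" "0 \<le> a \<Longrightarrow> a \<le> 1 \<Longrightarrow> \<Psi> a \<le> 1"
    and \<Psi>_borel [measurable]: "\<Psi> \<in> borel_measurable borel"
    and L_pos: "0 < L"
begin

definition chosen :: "(real \<Rightarrow> ennreal \<Rightarrow> real) \<Rightarrow> real \<Rightarrow> real \<Rightarrow> real" where
  "chosen F s x = \<Psi> (slice F s x)"

lemma chosen_mono: "F \<in> X_set \<Longrightarrow> x \<le> y \<Longrightarrow> chosen F s x \<le> chosen F s y"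
  unfolding chosen_def by (intro \<Psi>_mono slice_mono slice_bounds)

lemma chosen_bounds: "F \<in> X_set \<Longrightarrow> 0 \<le> chosen F s x" "F \<in> X_set \<Longrightarrow> chosen F s x \<le> 1"
  unfolding chosen_def by (intro \<Psi>_bounds slice_bounds; assumption)+

lemma chosen_right_continuous:
  assumes F: "F \<in> X_set"
  shows "continuous (at_right a) (chosen F s)"
proof -
  have "((\<lambda>x. L * \<bar>slice F s x - slice F s a\<bar>) \<longlongrightarrow> L * \<bar>slice F s a - slice F s a\<bar>) (at_right a)"
    using slice_right_continuous[OF F, of a s] by (intro tendsto_intros) (simp add: continuous_within)
  then have "((\<lambda>x. L * \<bar>slice F s x - slice F s a\<bar>) \<longlongrightarrow> 0) (at_right a)" by simp
  then have "((\<lambda>x. chosen F s x - chosen F s a) \<longlongrightarrow> 0) (at_right a)"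
    by (rule Lim_null_comparison[rotated])
      (auto intro!: always_eventually \<Psi>_Lipschitz slice_bounds[OF F] simp: chosen_def)
  then show ?thesis by (simp add: continuous_within LIM_zero_iff)
qed

lemma borel_measurable_chosen [measurable (raw)]:
  assumes [measurable (raw)]: "F \<in> X_set" and [measurable]: "g \<in> borel_measurable M" "h \<in> borel_measurable M"
  shows "(\<lambda>w. chosen F (g w) (h w)) \<in> borel_measurable M"
  unfolding chosen_def
  by (rule measurable_compose[OF borel_measurable_slice \<Psi>_borel]) fact+

lemma chosen_integrable:
  assumes F: "F \<in> X_set" and y: "0 < y"
  shows "set_integrable lborel {y<..} (\<lambda>w. chosen F s w / w\<^sup>2)"
proof (rule set_integrable_div_square[OF _ _ y])
  show "chosen F s \<in> borel_measurable borel" by (rule borel_measurable_chosen[OF F]) auto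
  show "\<bar>chosen F s z\<bar> \<le> 1" for z using chosen_bounds[OF F] by simp
qed

text \<open>
  By integration by parts (lemma \<open>flux_eq_tail_integral\<close>), this is the rate at which the solution
  grows along the characteristic \<open>s \<mapsto> exp s * y\<close> of the evolution equation.
\<close>

definition flux :: "(real \<Rightarrow> ennreal \<Rightarrow> real) \<Rightarrow> real \<Rightarrow> real \<Rightarrow> real" where
  "flux F s y = y\<^sup>2 * ((LINT w:{y<..}|lborel. chosen F s w / w\<^sup>2) - chosen F s y / y)"

lemma flux_eq_tail_integral:
  assumes F: "F \<in> X_set" and s: "0 \<le> s" and y: "0 < y"
  shows "y\<^sup>2 * tail_integral \<Psi> (F s) y = flux F s y"
proof -
  have "tail_integral \<Psi> (F s) y = (LINT z:{y<..}|interval_measure (chosen F s). 1 / z)"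
    using s by (simp add: tail_integral_def chosen_def[abs_def] slice_def)
  also have "\<dots> = (LINT w:{y<..}|lborel. (chosen F s w - chosen F s y) / w\<^sup>2)"
    by (rule integral_inverse_interval_measure[OF chosen_mono[OF F] chosen_right_continuous[OF F] y])
  also have "\<dots> = (LINT w:{y<..}|lborel. chosen F s w / w\<^sup>2 - chosen F s y * (1 / w\<^sup>2))"
    by (simp add: diff_divide_distrib)
  also have "\<dots> = (LINT w:{y<..}|lborel. chosen F s w / w\<^sup>2) - chosen F s y * (1 / y)"
    using inverse_square_tail[OF y] chosen_integrable[OF F y]
    by (subst set_integral_diff(2)) (auto simp del: times_divide_eq_right)
  finally show ?thesis by (simp add: flux_def)
qed

lemma integral_chosen_bounds:
  assumes F: "F \<in> X_set" and y: "0 < y"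
  shows "0 \<le> (LINT w:{y<..}|lborel. chosen F s w / w\<^sup>2)" "(LINT w:{y<..}|lborel. chosen F s w / w\<^sup>2) \<le> 1 / y"
proof -
  show "0 \<le> (LINT w:{y<..}|lborel. chosen F s w / w\<^sup>2)"
    unfolding set_lebesgue_integral_def using chosen_bounds[OF F] by (intro Bochner_Integration.integral_nonneg) auto
  show "(LINT w:{y<..}|lborel. chosen F s w / w\<^sup>2) \<le> 1 / y"
    unfolding inverse_square_tail(2)[OF y, symmetric] using chosen_bounds[OF F]
    by (intro set_integral_mono chosen_integrable[OF F y] inverse_square_tail[OF y] divide_right_mono) auto
qed

lemma flux_bound:
  assumes F: "F \<in> X_set" and y: "0 < y"
  shows "\<bar>flux F s y\<bar> \<le> y"
proof -
  have "0 \<le> chosen F s y / y" "chosen F s y / y \<le> 1 / y"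
    using chosen_bounds[OF F] y by (auto intro: divide_right_mono)
  then have "\<bar>(LINT w:{y<..}|lborel. chosen F s w / w\<^sup>2) - chosen F s y / y\<bar> \<le> 1 / y"
    using integral_chosen_bounds[OF F y, of s] by linarith
  then have "\<bar>flux F s y\<bar> \<le> y\<^sup>2 * (1 / y)"
    unfolding flux_def abs_mult by (intro mult_mono) auto
  then show ?thesis using y by (simp add: power2_eq_square)
qed

lemma borel_measurable_integral_chosen:
  assumes F: "F \<in> X_set" and [measurable]: "g \<in> borel_measurable M" "h \<in> borel_measurable M"
  shows "(\<lambda>w. LINT z:{h w<..}|lborel. chosen F (g w) z / z\<^sup>2) \<in> borel_measurable M"
proof -
  note [measurable (raw)] = borel_measurable_chosen[OF F]
  have "(\<lambda>w. LINT z|lborel. (if h w < z then chosen F (g w) z / z\<^sup>2 else 0)) \<in> borel_measurable M"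
    by measurable
  moreover have "(LINT z:{h w<..}|lborel. chosen F (g w) z / z\<^sup>2)
      = (LINT z|lborel. (if h w < z then chosen F (g w) z / z\<^sup>2 else 0))" for w
    unfolding set_lebesgue_integral_def by (intro Bochner_Integration.integral_cong) auto
  ultimately show ?thesis by simp
qed

lemma borel_measurable_flux:
  assumes F: "F \<in> X_set" and [measurable]: "g \<in> borel_measurable M" "h \<in> borel_measurable M"
  shows "(\<lambda>w. flux F (g w) (h w)) \<in> borel_measurable M"
  unfolding flux_def
  by (intro borel_measurable_times borel_measurable_diff borel_measurable_divide borel_measurable_power
      borel_measurable_integral_chosen borel_measurable_chosen assms)

lemma set_integrable_along_characteristic:
  fixes p :: "real \<Rightarrow> real"
  assumes p: "p \<in> borel_measurable borel" and t: "0 \<le> t"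
    and bd: "\<And>s. 0 \<le> s \<Longrightarrow> s \<le> t \<Longrightarrow> \<bar>p s\<bar> \<le> exp s * y" and y: "0 \<le> y"
  shows "set_integrable lborel {0..t} p"
  unfolding set_integrable_def
proof (rule integrableI_bounded_set[where A = "{0..t}" and B = "exp t * y"])
  show "(\<lambda>s. indicator {0..t} s *\<^sub>R p s) \<in> borel_measurable lborel" using p by measurable
  show "AE s in lborel. s \<in> {0..t} \<longrightarrow> norm (indicator {0..t} s *\<^sub>R p s) \<le> exp t * y"
  proof (intro always_eventually allI impI)
    fix s assume s: "s \<in> {0..t}"
    then have "\<bar>p s\<bar> \<le> exp s * y" by (intro bd) auto
    also have "\<dots> \<le> exp t * y" using s y by (intro mult_right_mono) auto
    finally show "norm (indicator {0..t} s *\<^sub>R p s) \<le> exp t * y" using s by simp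
  qed
qed (auto simp: emeasure_lborel_Icc_eq)

lemma flux_integrable:
  assumes F: "F \<in> X_set" and t: "0 \<le> t" and y: "0 < y"
  shows "set_integrable lborel {0..t} (\<lambda>s. flux F s (exp s * y))"
  using y by (intro set_integrable_along_characteristic[OF _ t, where y = y] borel_measurable_flux[OF F] flux_bound[OF F]) auto

text \<open>
  The evolution equation at the point \<open>exp t * y\<close>, in which the exponentials cancel.
\<close>

lemma solution_along_characteristic:
  assumes F: "F \<in> solutions \<Psi>" and t: "0 \<le> t" and y: "0 < y"
  shows "slice F t (exp t * y) = slice F 0 y + integral {0..t} (\<lambda>s. flux F s (exp s * y))"
proof -
  have X: "F \<in> X_set" using F by (auto simp: solutions_def X1_set_def)
  have "slice F t (exp t * y) = S_op \<Psi> F t (exp t * y)"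
    using F t y by (simp add: solutions_def slice_def)
  also have "\<dots> = slice F 0 y + (LINT s:{0..t}|lborel. flux F s (exp s * y))"
  proof -
    have e: "exp (s - t) * (exp t * y) = exp s * y" for s by (simp add: exp_diff)
    have "(LINT s:{0..t}|lborel. (exp (s - t) * (exp t * y))\<^sup>2 * tail_integral \<Psi> (F s) (exp (s - t) * (exp t * y)))
        = (LINT s:{0..t}|lborel. flux F s (exp s * y))"
      unfolding e using y by (intro set_lebesgue_integral_cong) (auto simp: flux_eq_tail_integral[OF X])
    moreover have e0: "exp (- t) * (exp t * y) = y" by (simp add: exp_minus)
    ultimately show ?thesis unfolding S_op_def e0 by (simp add: slice_def)
  qed
  also have "(LINT s:{0..t}|lborel. flux F s (exp s * y)) = integral {0..t} (\<lambda>s. flux F s (exp s * y))"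
    by (rule set_borel_integral_eq_integral[OF flux_integrable[OF X t y]])
  finally show ?thesis .
qed

end

locale solution_pair = choice_function +
  fixes F F' :: "real \<Rightarrow> ennreal \<Rightarrow> real"
  assumes F: "F \<in> solutions \<Psi>" and F': "F' \<in> solutions \<Psi>"
begin

lemma X: "F \<in> X_set" "F' \<in> X_set"
  using F F' by (auto simp: solutions_def X1_set_def)

definition D :: "real \<Rightarrow> real \<Rightarrow> real" where
  "D s x = slice F s x - slice F' s x"

definition \<delta> :: "real \<Rightarrow> real \<Rightarrow> real" where
  "\<delta> s x = chosen F s x - chosen F' s x"

definition A :: "real \<Rightarrow> real \<Rightarrow> real" where
  "A s x = (LINT z:{x<..}|lborel. \<bar>\<delta> s z\<bar> / z\<^sup>2)"

lemma borel_measurable_\<delta> [measurable (raw)]: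
  assumes "g \<in> borel_measurable M" "h \<in> borel_measurable M"
  shows "(\<lambda>w. \<delta> (g w) (h w)) \<in> borel_measurable M"
  unfolding \<delta>_def by (intro borel_measurable_diff borel_measurable_chosen X assms)

lemma borel_measurable_D [measurable (raw)]:
  assumes "g \<in> borel_measurable M" "h \<in> borel_measurable M"
  shows "(\<lambda>w. D (g w) (h w)) \<in> borel_measurable M"
  unfolding D_def by (intro borel_measurable_diff borel_measurable_slice X assms)

lemma \<delta>_le_1: "\<bar>\<delta> s x\<bar> \<le> 1"
  using chosen_bounds[OF X(1), of s x] chosen_bounds[OF X(2), of s x] by (simp add: \<delta>_def)

lemma \<delta>_Lipschitz: "\<bar>\<delta> s x\<bar> \<le> L * \<bar>D s x\<bar>"
  unfolding \<delta>_def D_def chosen_def by (intro \<Psi>_Lipschitz slice_bounds X)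

lemma \<delta>_sign: "0 \<le> D s x \<Longrightarrow> 0 \<le> \<delta> s x" "D s x \<le> 0 \<Longrightarrow> \<delta> s x \<le> 0"
  unfolding \<delta>_def D_def chosen_def by (auto intro!: \<Psi>_mono slice_bounds X)

lemma \<delta>_integrable: "0 < x \<Longrightarrow> set_integrable lborel {x<..} (\<lambda>z. \<delta> s z / z\<^sup>2)"
  by (rule set_integrable_div_square[OF _ \<delta>_le_1]) measurable

lemma abs_\<delta>_integrable: "0 < x \<Longrightarrow> set_integrable lborel {x<..} (\<lambda>z. \<bar>\<delta> s z\<bar> / z\<^sup>2)"
  by (rule set_integrable_div_square) (auto simp: \<delta>_le_1 intro!: borel_measurable_abs borel_measurable_\<delta>)

lemma A_bounds:
  assumes x: "0 < x"
  shows "0 \<le> A s x" "A s x \<le> 1 / x"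
proof -
  show "0 \<le> A s x"
    unfolding A_def set_lebesgue_integral_def by (intro Bochner_Integration.integral_nonneg) auto
  show "A s x \<le> 1 / x"
    unfolding A_def inverse_square_tail(2)[OF x, symmetric] using \<delta>_le_1
    by (intro set_integral_mono abs_\<delta>_integrable[OF x] inverse_square_tail[OF x] divide_right_mono) auto
qed

lemma ennreal_A:
  assumes x: "0 < x"
  shows "ennreal (A s x) = (\<integral>\<^sup>+z\<in>{x<..}. ennreal (\<bar>\<delta> s z\<bar> / z\<^sup>2) \<partial>lborel)"
  unfolding A_def by (intro set_nn_integral_eq_set_integral[symmetric] abs_\<delta>_integrable[OF x]) auto

lemma borel_measurable_A [measurable (raw)]:
  assumes [measurable]: "g \<in> borel_measurable M" "h \<in> borel_measurable M"
  shows "(\<lambda>w. A (g w) (h w)) \<in> borel_measurable M"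
proof -
  have "(\<lambda>w. LINT z|lborel. (if h w < z then \<bar>\<delta> (g w) z\<bar> / z\<^sup>2 else 0)) \<in> borel_measurable M"
    by measurable
  moreover have "A (g w) (h w) = (LINT z|lborel. (if h w < z then \<bar>\<delta> (g w) z\<bar> / z\<^sup>2 else 0))" for w
    unfolding A_def set_lebesgue_integral_def by (intro Bochner_Integration.integral_cong) auto
  ultimately show ?thesis by simp
qed

text \<open>
  The difference of the fluxes is the sum of a nonlocal gain term, of which only the size matters, and
  a local loss term, of which the sign matters: it pulls the two solutions together.
\<close>

lemma flux_difference:
  assumes x: "0 < x"
  obtains I where "\<bar>I\<bar> \<le> x\<^sup>2 * A s x" "flux F s x - flux F' s x = I - x * \<delta> s x"
proof -
  define I where "I = x\<^sup>2 * (LINT z:{x<..}|lborel. \<delta> s z / z\<^sup>2)"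
  have "\<bar>LINT z:{x<..}|lborel. \<delta> s z / z\<^sup>2\<bar> \<le> A s x"
    using set_integral_norm_bound[OF \<delta>_integrable[OF x], of s] by (simp add: A_def)
  then have "\<bar>I\<bar> \<le> x\<^sup>2 * A s x" unfolding I_def abs_mult by (intro mult_mono) auto
  have "(LINT z:{x<..}|lborel. \<delta> s z / z\<^sup>2)
      = (LINT z:{x<..}|lborel. chosen F s z / z\<^sup>2) - (LINT z:{x<..}|lborel. chosen F' s z / z\<^sup>2)"
    unfolding \<delta>_def diff_divide_distrib
    by (intro set_integral_diff(2) chosen_integrable X x)
  moreover have "x\<^sup>2 * (a - p / x) - x\<^sup>2 * (b - q / x) = x\<^sup>2 * (a - b) - x * (p - q)" for a b p q :: real
    using x by (simp add: field_simps power2_eq_square)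
  ultimately have "flux F s x - flux F' s x = I - x * \<delta> s x"
    by (simp only: flux_def I_def) (simp only: \<delta>_def)
  with \<open>\<bar>I\<bar> \<le> x\<^sup>2 * A s x\<close> show thesis by (rule that)
qed

text \<open>
  As \<open>\<Psi>\<close> is nondecreasing, \<open>\<delta>\<close> and \<open>D\<close> never have opposite signs.  Hence the loss term enters the rate of change of
  \<open>\<bar>D\<bar>\<close> along a characteristic with its full size and a negative sign; keeping it is essential, since
  it will cancel the gain term after integration over \<open>y\<close>.
\<close>

lemma difference_along_characteristic:
  assumes t: "0 \<le> t" and y: "0 < y"
  shows "\<bar>D t (exp t * y)\<bar> \<le> \<bar>D 0 y\<bar>
    + integral {0..t} (\<lambda>s. (exp s * y)\<^sup>2 * A s (exp s * y) - exp s * y * \<bar>\<delta> s (exp s * y)\<bar>)"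
    and "set_integrable lborel {0..t} (\<lambda>s. (exp s * y)\<^sup>2 * A s (exp s * y))"
    and "set_integrable lborel {0..t} (\<lambda>s. exp s * y * \<bar>\<delta> s (exp s * y)\<bar>)"
proof -
  let ?x = "\<lambda>s. exp s * y"
  let ?u = "\<lambda>s. D s (?x s)" and ?v = "\<lambda>s. flux F s (?x s) - flux F' s (?x s)"
  let ?r = "\<lambda>s. (?x s)\<^sup>2 * A s (?x s) - ?x s * \<bar>\<delta> s (?x s)\<bar>"
  have x: "0 < ?x s" for s using y by simp
  show int1: "set_integrable lborel {0..t} (\<lambda>s. (?x s)\<^sup>2 * A s (?x s))"
  proof (rule set_integrable_along_characteristic[OF _ t, where y = y])
    fix s
    have "(?x s)\<^sup>2 * A s (?x s) \<le> (?x s)\<^sup>2 * (1 / ?x s)"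
      using A_bounds[OF x] by (intro mult_left_mono) auto
    then show "\<bar>(?x s)\<^sup>2 * A s (?x s)\<bar> \<le> ?x s"
      using A_bounds(1)[OF x, of s s] y by (simp add: abs_mult power2_eq_square)
  qed (use y in \<open>auto intro!: borel_measurable_times borel_measurable_power borel_measurable_A\<close>)
  show int2: "set_integrable lborel {0..t} (\<lambda>s. ?x s * \<bar>\<delta> s (?x s)\<bar>)"
  proof (rule set_integrable_along_characteristic[OF _ t, where y = y])
    fix s
    show "\<bar>?x s * \<bar>\<delta> s (?x s)\<bar>\<bar> \<le> ?x s"
      using mult_left_mono[OF \<delta>_le_1, of "?x s" s "?x s"] y by (simp add: abs_mult)
  qed (use y in \<open>auto intro!: borel_measurable_times borel_measurable_abs borel_measurable_\<delta>\<close>)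
  have v_on: "(\<lambda>s. flux H s (?x s)) integrable_on {0..t'}" if "H \<in> X_set" "0 \<le> t'" for H t'
    by (rule set_borel_integral_eq_integral(1)[OF flux_integrable[OF that y]])
  have "\<bar>?u t\<bar> \<le> \<bar>?u 0\<bar> + integral {0..t} ?r"
  proof (rule abs_le_integral_of_rate[OF t, where v = ?v])
    show "?v integrable_on {0..t}" by (intro integrable_diff v_on X t)
    show "?r integrable_on {0..t}"
      by (intro integrable_diff set_borel_integral_eq_integral(1) int1 int2)
    show "?u s = ?u 0 + integral {0..s} ?v" if "0 \<le> s" for s
      using solution_along_characteristic[OF F that y] solution_along_characteristic[OF F' that y]
        Henstock_Kurzweil_Integration.integral_diff[OF v_on[OF X(1) that] v_on[OF X(2) that]]
      by (simp add: D_def)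
    show "?v s \<le> ?r s" if "0 < ?u s" for s
    proof -
      obtain I where I: "\<bar>I\<bar> \<le> (?x s)\<^sup>2 * A s (?x s)" "?v s = I - ?x s * \<delta> s (?x s)"
        by (rule flux_difference[OF x])
      have "\<bar>\<delta> s (?x s)\<bar> = \<delta> s (?x s)" using \<delta>_sign(1)[of s "?x s"] that by simp
      with I show ?thesis by (simp add: abs_le_iff)
    qed
    show "- ?v s \<le> ?r s" if "?u s < 0" for s
    proof -
      obtain I where I: "\<bar>I\<bar> \<le> (?x s)\<^sup>2 * A s (?x s)" "?v s = I - ?x s * \<delta> s (?x s)"
        by (rule flux_difference[OF x])
      have "\<bar>\<delta> s (?x s)\<bar> = - \<delta> s (?x s)" using \<delta>_sign(2)[of s "?x s"] that by simp
      with I show ?thesis by (simp add: abs_le_iff)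
    qed
    fix \<eta> :: real assume \<eta>: "0 < \<eta>"
    \<comment> \<open>for \<open>\<bar>D\<bar> < \<epsilon>\<close> the loss term, by which \<open>\<bar>v\<bar>\<close> may exceed the two signed bounds,
        counts twice and is at most \<open>\<eta>/2\<close>\<close>
    define \<epsilon> where "\<epsilon> = \<eta> / (2 * (?x t * L))"
    have "0 < \<epsilon>" using \<eta> y L_pos by (simp add: \<epsilon>_def)
    moreover have "\<bar>?v s\<bar> \<le> ?r s + \<eta>" if s: "0 \<le> s" "s \<le> t" "\<bar>?u s\<bar> < \<epsilon>" for s
    proof -
      obtain I where I: "\<bar>I\<bar> \<le> (?x s)\<^sup>2 * A s (?x s)" "?v s = I - ?x s * \<delta> s (?x s)"
        by (rule flux_difference[OF x])
      have "?x s * \<bar>\<delta> s (?x s)\<bar> \<le> ?x t * (L * \<epsilon>)"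
      proof (rule mult_mono)
        show "?x s \<le> ?x t" using s y by simp
        have "\<bar>\<delta> s (?x s)\<bar> \<le> L * \<bar>?u s\<bar>" by (rule \<delta>_Lipschitz)
        also have "\<dots> \<le> L * \<epsilon>" using s L_pos by (intro mult_left_mono) auto
        finally show "\<bar>\<delta> s (?x s)\<bar> \<le> L * \<epsilon>" .
      qed (use y in auto)
      also have "?x t * (L * \<epsilon>) = \<eta> / 2" using y L_pos by (simp add: \<epsilon>_def)
      finally have "?x s * \<bar>\<delta> s (?x s)\<bar> \<le> \<eta> / 2" .
      moreover have "\<bar>?v s\<bar> \<le> \<bar>I\<bar> + ?x s * \<bar>\<delta> s (?x s)\<bar>"
        unfolding I(2) using y abs_triangle_ineq4[of I "?x s * \<delta> s (?x s)"] by (simp add: abs_mult)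
      ultimately show ?thesis using I(1) by linarith
    qed
    ultimately show "\<exists>\<epsilon>>0. \<forall>s. 0 \<le> s \<and> s \<le> t \<and> \<bar>?u s\<bar> < \<epsilon> \<longrightarrow> \<bar>?v s\<bar> \<le> ?r s + \<eta>" by blast
  qed
  then show "\<bar>D t (?x t)\<bar> \<le> \<bar>D 0 y\<bar> + integral {0..t} ?r" by simp
qed

text \<open>
  The loss term is moved to the left, so that all terms are nonnegative and Tonelli's theorem
  applies when the inequality is integrated over \<open>y\<close>.
\<close>

lemma ennreal_difference_along_characteristic:
  assumes t: "0 \<le> t" and y: "0 < y"
  shows "ennreal \<bar>D t (exp t * y)\<bar> + (\<integral>\<^sup>+s\<in>{0..t}. ennreal (exp s * y * \<bar>\<delta> s (exp s * y)\<bar>) \<partial>lborel)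
    \<le> ennreal \<bar>D 0 y\<bar> + (\<integral>\<^sup>+s\<in>{0..t}. ennreal ((exp s * y)\<^sup>2 * A s (exp s * y)) \<partial>lborel)"
proof -
  let ?f = "\<lambda>s. (exp s * y)\<^sup>2 * A s (exp s * y)" and ?g = "\<lambda>s. exp s * y * \<bar>\<delta> s (exp s * y)\<bar>"
  note char = difference_along_characteristic[OF t y]
  have nonneg: "0 \<le> ?f s" "0 \<le> ?g s" for s using y A_bounds(1)[of "exp s * y" s] by auto
  have "integral {0..t} (\<lambda>s. ?f s - ?g s) = (LINT s:{0..t}|lborel. ?f s) - (LINT s:{0..t}|lborel. ?g s)"
    unfolding set_borel_integral_eq_integral(2)[OF char(2)] set_borel_integral_eq_integral(2)[OF char(3)]
    by (intro Henstock_Kurzweil_Integration.integral_diff set_borel_integral_eq_integral(1) char)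
  then have le: "\<bar>D t (exp t * y)\<bar> + (LINT s:{0..t}|lborel. ?g s) \<le> \<bar>D 0 y\<bar> + (LINT s:{0..t}|lborel. ?f s)"
    using char(1) by simp
  have "0 \<le> (LINT s:{0..t}|lborel. ?f s)" "0 \<le> (LINT s:{0..t}|lborel. ?g s)"
    unfolding set_lebesgue_integral_def using nonneg by (auto intro!: Bochner_Integration.integral_nonneg)
  then show ?thesis
    using ennreal_leI[OF le] by (simp add: set_nn_integral_eq_set_integral[OF char(2) nonneg(1)]
        set_nn_integral_eq_set_integral[OF char(3) nonneg(2)] ennreal_plus)
qed

end

section \<open>Contraction in the weighted norm\<close>

lemma nn_integral_scaled_Ioc:
  fixes g :: "real \<Rightarrow> ennreal" and c :: real
  assumes [measurable]: "g \<in> borel_measurable borel" and c: "0 < c"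
  shows "(\<integral>\<^sup>+y\<in>{0<..R}. g (c * y) \<partial>lborel) = ennreal (1 / c) * (\<integral>\<^sup>+x\<in>{0<..c * R}. g x \<partial>lborel)"
proof -
  have ind: "indicator {0<..c * R} (c * y) = (indicator {0<..R} y :: ennreal)" for y
    using c by (auto simp: indicator_def zero_less_mult_iff)
  have "(\<integral>\<^sup>+x\<in>{0<..c * R}. g x \<partial>lborel) = ennreal \<bar>c\<bar> * (\<integral>\<^sup>+y. g (0 + c * y) * indicator {0<..c * R} (0 + c * y) \<partial>lborel)"
    using c by (intro nn_integral_real_affine) auto
  also have "\<dots> = ennreal c * (\<integral>\<^sup>+y\<in>{0<..R}. g (c * y) \<partial>lborel)"
    using c by (simp add: ind)
  finally have "ennreal (1 / c) * (\<integral>\<^sup>+x\<in>{0<..c * R}. g x \<partial>lborel)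
      = (ennreal (1 / c) * ennreal c) * (\<integral>\<^sup>+y\<in>{0<..R}. g (c * y) \<partial>lborel)"
    by (simp add: mult.assoc)
  also have "ennreal (1 / c) * ennreal c = 1" using c by (simp flip: ennreal_mult)
  finally show ?thesis by simp
qed

lemma nn_integral_swap_weighted:
  fixes q :: "real \<Rightarrow> real \<Rightarrow> ennreal" and a :: "real \<Rightarrow> ennreal"
  assumes [measurable]: "case_prod q \<in> borel_measurable (borel \<Otimes>\<^sub>M borel)" "a \<in> borel_measurable borel"
    and [measurable]: "S \<in> sets borel" "T \<in> sets borel"
  shows "(\<integral>\<^sup>+y\<in>T. a y * (\<integral>\<^sup>+s\<in>S. q s y \<partial>lborel) \<partial>lborel) = (\<integral>\<^sup>+s\<in>S. (\<integral>\<^sup>+y\<in>T. a y * q s y \<partial>lborel) \<partial>lborel)"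
proof -
  have "(\<integral>\<^sup>+y\<in>T. a y * (\<integral>\<^sup>+s\<in>S. q s y \<partial>lborel) \<partial>lborel)
      = (\<integral>\<^sup>+y. (\<integral>\<^sup>+s. a y * q s y * indicator S s * indicator T y \<partial>lborel) \<partial>lborel)"
  proof (rule nn_integral_cong)
    fix y
    have "(\<integral>\<^sup>+s. a y * indicator T y * (q s y * indicator S s) \<partial>lborel) = a y * indicator T y * (\<integral>\<^sup>+s\<in>S. q s y \<partial>lborel)"
      by (rule nn_integral_cmult) measurable
    then show "a y * (\<integral>\<^sup>+s\<in>S. q s y \<partial>lborel) * indicator T y = (\<integral>\<^sup>+s. a y * q s y * indicator S s * indicator T y \<partial>lborel)"
      by (simp add: mult_ac)
  qed
  also have "\<dots> = (\<integral>\<^sup>+s. (\<integral>\<^sup>+y. a y * q s y * indicator S s * indicator T y \<partial>lborel) \<partial>lborel)"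
    by (rule lborel_pair.Fubini') measurable
  also have "\<dots> = (\<integral>\<^sup>+s\<in>S. (\<integral>\<^sup>+y\<in>T. a y * q s y \<partial>lborel) \<partial>lborel)"
  proof (rule nn_integral_cong)
    fix s
    have "(\<integral>\<^sup>+y. (a y * q s y * indicator T y) * indicator S s \<partial>lborel) = (\<integral>\<^sup>+y\<in>T. a y * q s y \<partial>lborel) * indicator S s"
      by (rule nn_integral_multc) measurable
    then show "(\<integral>\<^sup>+y. a y * q s y * indicator S s * indicator T y \<partial>lborel) = (\<integral>\<^sup>+y\<in>T. a y * q s y \<partial>lborel) * indicator S s"
      by (simp add: mult_ac)
  qed
  finally show ?thesis .
qed

lemma nn_integral_Ioi_le_of_Ioc:
  fixes f :: "real \<Rightarrow> ennreal"
  assumes [measurable]: "f \<in> borel_measurable borel"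
    and le: "\<And>b. b0 \<le> b \<Longrightarrow> (\<integral>\<^sup>+x\<in>{0<..b}. f x \<partial>lborel) \<le> c"
  shows "(\<integral>\<^sup>+x\<in>{0<..}. f x \<partial>lborel) \<le> c"
proof -
  let ?A = "\<lambda>n. {0<..max b0 (real n)}"
  have UN: "(\<Union>n. ?A n) = {0<..}"
    using real_arch_simple[where 'a = real] by (auto simp: le_max_iff_disj)
  have "(\<integral>\<^sup>+x\<in>{0<..}. f x \<partial>lborel) = emeasure (density lborel f) (\<Union>n. ?A n)"
    unfolding UN by (simp add: emeasure_density)
  also have "\<dots> = (SUP n. emeasure (density lborel f) (?A n))"
    by (rule SUP_emeasure_incseq[symmetric]) (auto simp: incseq_def)
  also have "\<dots> \<le> c"
    by (rule SUP_least) (auto simp: emeasure_density intro!: le)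
  finally show ?thesis .
qed

lemma norm_xm2_eq_Ioi: "norm_xm2 f = (\<integral>\<^sup>+x\<in>{0<..}. ennreal (\<bar>f x\<bar> / x\<^sup>2) \<partial>lborel)"
  unfolding norm_xm2_def by (intro nn_integral_cong) (auto simp: indicator_def)

context solution_pair
begin

lemma D_norm_le_2: "(\<integral>\<^sup>+x\<in>{0<..}. ennreal (\<bar>D s x\<bar> / x\<^sup>2) \<partial>lborel) \<le> 2"
proof -
  have le1: "(\<integral>\<^sup>+x\<in>{0<..}. ennreal (slice H s x / x\<^sup>2) \<partial>lborel) \<le> 1" if "H \<in> solutions \<Psi>" for H
  proof -
    have H: "H (max 0 s) \<in> D1_set" and HX: "H \<in> X_set" using that by (auto simp: solutions_def X1_set_def)
    have "(\<integral>\<^sup>+x\<in>{0<..}. ennreal (slice H s x / x\<^sup>2) \<partial>lborel) = norm_xm2 (slice H s)"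
      unfolding norm_xm2_eq_Ioi using slice_bounds(1)[OF HX] by simp
    also have "\<dots> \<le> 1" using H by (simp add: D1_set_def slice_def[abs_def])
    finally show ?thesis .
  qed
  have [measurable]: "slice F s \<in> borel_measurable borel" "slice F' s \<in> borel_measurable borel"
    by (intro borel_measurable_slice X; simp)+
  have "(\<integral>\<^sup>+x\<in>{0<..}. ennreal (\<bar>D s x\<bar> / x\<^sup>2) \<partial>lborel)
      \<le> (\<integral>\<^sup>+x. ennreal (slice F s x / x\<^sup>2) * indicator {0<..} x + ennreal (slice F' s x / x\<^sup>2) * indicator {0<..} x \<partial>lborel)"
  proof (intro nn_integral_mono)
    fix x
    have "\<bar>D s x\<bar> / x\<^sup>2 \<le> slice F s x / x\<^sup>2 + slice F' s x / x\<^sup>2"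
      unfolding add_divide_distrib[symmetric] using slice_bounds(1)[OF X(1), of s x] slice_bounds(1)[OF X(2), of s x]
      by (intro divide_right_mono) (auto simp: D_def)
    then have "ennreal (\<bar>D s x\<bar> / x\<^sup>2) \<le> ennreal (slice F s x / x\<^sup>2 + slice F' s x / x\<^sup>2)"
      by (rule ennreal_leI)
    also have "\<dots> = ennreal (slice F s x / x\<^sup>2) + ennreal (slice F' s x / x\<^sup>2)"
      using slice_bounds(1)[OF X(1), of s x] slice_bounds(1)[OF X(2), of s x] by (intro ennreal_plus) auto
    finally have "ennreal (\<bar>D s x\<bar> / x\<^sup>2) \<le> ennreal (slice F s x / x\<^sup>2) + ennreal (slice F' s x / x\<^sup>2)" .
    then show "ennreal (\<bar>D s x\<bar> / x\<^sup>2) * indicator {0<..} x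
        \<le> ennreal (slice F s x / x\<^sup>2) * indicator {0<..} x + ennreal (slice F' s x / x\<^sup>2) * indicator {0<..} x"
      by (simp add: indicator_def)
  qed
  also have "\<dots> = (\<integral>\<^sup>+x\<in>{0<..}. ennreal (slice F s x / x\<^sup>2) \<partial>lborel) + (\<integral>\<^sup>+x\<in>{0<..}. ennreal (slice F' s x / x\<^sup>2) \<partial>lborel)"
    by (intro nn_integral_add) measurable
  also have "\<dots> \<le> 1 + 1" by (intro add_mono le1 F F')
  finally show ?thesis by simp
qed

text \<open>
  Exchanging the integrals, \<open>\<bar>\<delta>(z)\<bar>/z\<^sup>2\<close> is weighted by the length \<open>min z b\<close> of the set of admissible
  \<open>x\<close>.  The part \<open>z \<le> b\<close> is the total loss on \<open>(0, b]\<close>, and the part \<open>z > b\<close> is at most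
  \<open>\<eta> b\<close> times the integral \<open>1/b\<close> of \<open>1/z\<^sup>2\<close>.
\<close>

lemma nn_integral_A_le:
  assumes b: "0 < b" and \<eta>: "\<And>z. b < z \<Longrightarrow> \<bar>\<delta> s z\<bar> \<le> \<eta>"
  shows "(\<integral>\<^sup>+x\<in>{0<..b}. ennreal (A s x) \<partial>lborel) \<le> (\<integral>\<^sup>+x\<in>{0<..b}. ennreal (\<bar>\<delta> s x\<bar> / x) \<partial>lborel) + ennreal \<eta>"
proof -
  have \<eta>0: "0 \<le> \<eta>" using \<eta>[of "b + 1"] by (rule order_trans[OF abs_ge_zero]) simp
  let ?d = "\<lambda>z. ennreal (\<bar>\<delta> s z\<bar> / z\<^sup>2)"
  have "(\<integral>\<^sup>+x\<in>{0<..b}. ennreal (A s x) \<partial>lborel)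
      = (\<integral>\<^sup>+x. (\<integral>\<^sup>+z. ?d z * (if 0 < x \<and> x \<le> b \<and> x < z then 1 else 0) \<partial>lborel) \<partial>lborel)"
  proof (rule nn_integral_cong)
    fix x
    have "ennreal (A s x) * indicator {0<..b} x = (\<integral>\<^sup>+z\<in>{x<..}. ?d z \<partial>lborel) * indicator {0<..b} x"
      by (cases "0 < x") (auto simp: ennreal_A)
    also have "\<dots> = (\<integral>\<^sup>+z. ?d z * indicator {x<..} z * indicator {0<..b} x \<partial>lborel)"
      by (rule nn_integral_multc[symmetric]) measurable
    also have "\<dots> = (\<integral>\<^sup>+z. ?d z * (if 0 < x \<and> x \<le> b \<and> x < z then 1 else 0) \<partial>lborel)"
      by (intro nn_integral_cong) (auto simp: indicator_def)
    finally show "ennreal (A s x) * indicator {0<..b} x = (\<integral>\<^sup>+z. ?d z * (if 0 < x \<and> x \<le> b \<and> x < z then 1 else 0) \<partial>lborel)" .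
  qed
  also have "\<dots> = (\<integral>\<^sup>+z. (\<integral>\<^sup>+x. ?d z * (if 0 < x \<and> x \<le> b \<and> x < z then 1 else 0) \<partial>lborel) \<partial>lborel)"
    by (rule lborel_pair.Fubini') measurable
  also have "\<dots> \<le> (\<integral>\<^sup>+z. ennreal (\<bar>\<delta> s z\<bar> / z) * indicator {0<..b} z
      + ennreal (\<eta> * b) * (ennreal (1 / z\<^sup>2) * indicator {b..} z) \<partial>lborel)"
  proof (rule nn_integral_mono)
    fix z
    have inner: "(\<integral>\<^sup>+x. ?d z * (if 0 < x \<and> x \<le> b \<and> x < z then 1 else 0) \<partial>lborel) \<le> ?d z * ennreal c"
      if "{x. 0 < x \<and> x \<le> b \<and> x < z} \<subseteq> {0<..c}" "0 \<le> c" for c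
    proof -
      have "(\<integral>\<^sup>+x. ?d z * (if 0 < x \<and> x \<le> b \<and> x < z then 1 else 0) \<partial>lborel) \<le> (\<integral>\<^sup>+x. ?d z * indicator {0<..c} x \<partial>lborel)"
      proof (rule nn_integral_mono)
        fix x
        show "?d z * (if 0 < x \<and> x \<le> b \<and> x < z then 1 else 0) \<le> ?d z * indicator {0<..c} x"
        proof (cases "0 < x \<and> x \<le> b \<and> x < z")
          case True
          then have "x \<in> {0<..c}" using that(1) by blast
          then show ?thesis by simp
        qed auto
      qed
      also have "\<dots> = ?d z * ennreal c" using that by (simp add: nn_integral_cmult_indicator)
      finally show ?thesis .
    qed
    consider "z \<le> 0" | "0 < z" "z \<le> b" | "b < z" by linarith
    then show "(\<integral>\<^sup>+x. ?d z * (if 0 < x \<and> x \<le> b \<and> x < z then 1 else 0) \<partial>lborel)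
        \<le> ennreal (\<bar>\<delta> s z\<bar> / z) * indicator {0<..b} z + ennreal (\<eta> * b) * (ennreal (1 / z\<^sup>2) * indicator {b..} z)"
    proof cases
      case 1
      then show ?thesis using inner[of 0] by auto
    next
      case 2
      have "?d z * ennreal z = ennreal (\<bar>\<delta> s z\<bar> / z)"
        using 2 by (simp add: power2_eq_square flip: ennreal_mult)
      then show ?thesis using inner[of z] 2 by (auto intro: order_trans simp: subset_iff)
    next
      case 3
      have "?d z * ennreal b \<le> ennreal (\<eta> * b) * ennreal (1 / z\<^sup>2)"
        using 3 b \<eta>[OF 3] \<eta>0 by (auto simp flip: ennreal_mult intro!: ennreal_leI divide_right_mono mult_right_mono)
      moreover have "{x. 0 < x \<and> x \<le> b \<and> x < z} \<subseteq> {0<..b}" by auto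
      ultimately show ?thesis using order_trans[OF inner[OF _ less_imp_le[OF b]]] 3 b by simp
    qed
  qed
  also have "\<dots> = (\<integral>\<^sup>+z\<in>{0<..b}. ennreal (\<bar>\<delta> s z\<bar> / z) \<partial>lborel)
      + (\<integral>\<^sup>+z. ennreal (\<eta> * b) * (ennreal (1 / z\<^sup>2) * indicator {b..} z) \<partial>lborel)"
    by (rule nn_integral_add) measurable
  also have "(\<integral>\<^sup>+z. ennreal (\<eta> * b) * (ennreal (1 / z\<^sup>2) * indicator {b..} z) \<partial>lborel) = ennreal \<eta>"
    using b \<eta>0 by (simp add: nn_integral_cmult nn_integral_inverse_square flip: ennreal_mult)
  finally show ?thesis .
qed

text \<open>
  The loss at time \<open>s\<close> on all characteristics that start in \<open>(0, R]\<close>, with the weight \<open>1/y\<^sup>2\<close>, after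
  the substitution \<open>x = exp s * y\<close>.
\<close>

definition loss :: "real \<Rightarrow> real \<Rightarrow> ennreal" where
  "loss R s = ennreal (exp s) * (\<integral>\<^sup>+x\<in>{0<..exp s * R}. ennreal (\<bar>\<delta> s x\<bar> / x) \<partial>lborel)"

lemma nn_integral_loss_term:
  "(\<integral>\<^sup>+y\<in>{0<..R}. ennreal (1 / y\<^sup>2) * ennreal (exp s * y * \<bar>\<delta> s (exp s * y)\<bar>) \<partial>lborel) = loss R s"
proof -
  have "(\<integral>\<^sup>+y\<in>{0<..R}. ennreal (1 / y\<^sup>2) * ennreal (exp s * y * \<bar>\<delta> s (exp s * y)\<bar>) \<partial>lborel)
      = (\<integral>\<^sup>+y\<in>{0<..R}. ennreal ((exp s)\<^sup>2) * ennreal (\<bar>\<delta> s (exp s * y)\<bar> / (exp s * y)) \<partial>lborel)"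
    by (intro nn_integral_cong) (auto simp: indicator_def power2_eq_square simp flip: ennreal_mult)
  also have "\<dots> = ennreal (1 / exp s) * (\<integral>\<^sup>+x\<in>{0<..exp s * R}. ennreal ((exp s)\<^sup>2) * ennreal (\<bar>\<delta> s x\<bar> / x) \<partial>lborel)"
    by (rule nn_integral_scaled_Ioc) auto
  also have "\<dots> = ennreal (1 / exp s) * (ennreal ((exp s)\<^sup>2) * (\<integral>\<^sup>+x\<in>{0<..exp s * R}. ennreal (\<bar>\<delta> s x\<bar> / x) \<partial>lborel))"
    by (simp add: nn_integral_cmult mult.assoc)
  also have "\<dots> = loss R s"
    by (simp add: loss_def power2_eq_square flip: mult.assoc ennreal_mult)
  finally show ?thesis .
qed

text \<open>
  Gain and loss balance on \<open>(0, R]\<close>, up to what enters from beyond \<open>R\<close>.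
\<close>

lemma nn_integral_gain_term:
  assumes R: "0 < R" and s: "0 \<le> s" and \<eta>: "\<And>z. R < z \<Longrightarrow> \<bar>\<delta> s z\<bar> \<le> \<eta>"
  shows "(\<integral>\<^sup>+y\<in>{0<..R}. ennreal (1 / y\<^sup>2) * ennreal ((exp s * y)\<^sup>2 * A s (exp s * y)) \<partial>lborel) \<le> loss R s + ennreal (exp s * \<eta>)"
proof -
  have \<eta>0: "0 \<le> \<eta>" using \<eta>[of "R + 1"] by (rule order_trans[OF abs_ge_zero]) simp
  have R': "R \<le> exp s * R" using R s mult_right_mono[of 1 "exp s" R] by simp
  have \<eta>': "\<bar>\<delta> s z\<bar> \<le> \<eta>" if "exp s * R < z" for z
    by (rule \<eta>[OF le_less_trans[OF R' that]])
  have "(\<integral>\<^sup>+y\<in>{0<..R}. ennreal (1 / y\<^sup>2) * ennreal ((exp s * y)\<^sup>2 * A s (exp s * y)) \<partial>lborel)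
      = (\<integral>\<^sup>+y\<in>{0<..R}. ennreal ((exp s)\<^sup>2) * ennreal (A s (exp s * y)) \<partial>lborel)"
    using A_bounds(1)
    by (intro nn_integral_cong) (auto simp: indicator_def power_mult_distrib simp flip: ennreal_mult)
  also have "\<dots> = ennreal (1 / exp s) * (\<integral>\<^sup>+x\<in>{0<..exp s * R}. ennreal ((exp s)\<^sup>2) * ennreal (A s x) \<partial>lborel)"
    by (rule nn_integral_scaled_Ioc) auto
  also have "\<dots> = ennreal (1 / exp s) * (ennreal ((exp s)\<^sup>2) * (\<integral>\<^sup>+x\<in>{0<..exp s * R}. ennreal (A s x) \<partial>lborel))"
    by (simp add: nn_integral_cmult mult.assoc)
  also have "\<dots> = ennreal (exp s) * (\<integral>\<^sup>+x\<in>{0<..exp s * R}. ennreal (A s x) \<partial>lborel)"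
    by (simp add: power2_eq_square flip: mult.assoc ennreal_mult)
  also have "\<dots> \<le> ennreal (exp s) * ((\<integral>\<^sup>+x\<in>{0<..exp s * R}. ennreal (\<bar>\<delta> s x\<bar> / x) \<partial>lborel) + ennreal \<eta>)"
    using R by (intro mult_left_mono nn_integral_A_le \<eta>') auto
  also have "\<dots> = loss R s + ennreal (exp s * \<eta>)"
    using \<eta>0 by (simp add: loss_def distrib_left ennreal_mult)
  finally show ?thesis .
qed

text \<open>
  The cutoff \<open>R\<close> is there for this bound: without it the loss may be infinite, as \<open>\<bar>\<delta>(x)\<bar>/x\<close> need not
  be integrable at infinity, and could not be cancelled.
\<close>

lemma loss_bound:
  assumes R: "0 < R" and s: "0 \<le> s" "s \<le> t"
  shows "loss R s \<le> ennreal (2 * (exp t * (L * (exp t * R))))"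
proof -
  have "(\<integral>\<^sup>+x\<in>{0<..exp s * R}. ennreal (\<bar>\<delta> s x\<bar> / x) \<partial>lborel)
      \<le> (\<integral>\<^sup>+x. ennreal (L * (exp t * R)) * (ennreal (\<bar>D s x\<bar> / x\<^sup>2) * indicator {0<..} x) \<partial>lborel)"
  proof (rule nn_integral_mono)
    fix x
    show "ennreal (\<bar>\<delta> s x\<bar> / x) * indicator {0<..exp s * R} x
        \<le> ennreal (L * (exp t * R)) * (ennreal (\<bar>D s x\<bar> / x\<^sup>2) * indicator {0<..} x)"
    proof (cases "0 < x \<and> x \<le> exp s * R")
      case True
      have "exp s * R \<le> exp t * R" using s R by (intro mult_right_mono) auto
      with True have "x \<le> exp t * R" by linarith
      have "\<bar>\<delta> s x\<bar> / x = \<bar>\<delta> s x\<bar> * x / x\<^sup>2" using True by (simp add: power2_eq_square)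
      also have "\<dots> \<le> (L * \<bar>D s x\<bar>) * (exp t * R) / x\<^sup>2"
        using True \<open>x \<le> exp t * R\<close> L_pos by (intro divide_right_mono mult_mono \<delta>_Lipschitz) auto
      finally have "\<bar>\<delta> s x\<bar> / x \<le> (L * (exp t * R)) * (\<bar>D s x\<bar> / x\<^sup>2)" by (simp add: mult_ac)
      then show ?thesis
        using True L_pos R by (auto simp: simp flip: ennreal_mult intro!: ennreal_leI)
    qed (auto simp: indicator_def)
  qed
  also have "\<dots> \<le> ennreal (L * (exp t * R)) * 2"
    using D_norm_le_2[of s] by (subst nn_integral_cmult) (auto intro: mult_left_mono)
  finally have "loss R s \<le> ennreal (exp t) * (ennreal (L * (exp t * R)) * 2)"
    unfolding loss_def using s by (intro mult_mono) auto
  also have "\<dots> = ennreal (2 * (exp t * (L * (exp t * R))))"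
    using L_pos R by (simp add: ennreal_mult mult_ac)
  finally show ?thesis .
qed

lemma borel_measurable_loss [measurable]: "loss R \<in> borel_measurable borel"
proof -
  have "(\<lambda>s. ennreal (exp s) * (\<integral>\<^sup>+x. ennreal (\<bar>\<delta> s x\<bar> / x) * (if 0 < x \<and> x \<le> exp s * R then 1 else 0) \<partial>lborel)) \<in> borel_measurable borel"
    by measurable
  also have "(\<lambda>s. ennreal (exp s) * (\<integral>\<^sup>+x. ennreal (\<bar>\<delta> s x\<bar> / x) * (if 0 < x \<and> x \<le> exp s * R then 1 else 0) \<partial>lborel)) = loss R"
    unfolding loss_def[abs_def] by (intro ext arg_cong2[where f = times] refl nn_integral_cong) (auto simp: indicator_def)
  finally show ?thesis .
qed

text \<open>
  Integrate the inequality along characteristics over \<open>y \<in> (0, R]\<close> with weight \<open>1/y\<^sup>2\<close>.  The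
  substitution \<open>x = exp t * y\<close> on the left produces the factor \<open>exp t\<close>, which is the source of the
  exponential decay; the loss cancels.
\<close>

lemma truncated_contraction:
  assumes t: "0 \<le> t" and R: "0 < R" and \<eta>0: "0 \<le> \<eta>"
    and \<eta>: "\<And>s z. 0 \<le> s \<Longrightarrow> s \<le> t \<Longrightarrow> R < z \<Longrightarrow> \<bar>\<delta> s z\<bar> \<le> \<eta>"
  shows "(\<integral>\<^sup>+x\<in>{0<..exp t * R}. ennreal (\<bar>D t x\<bar> / x\<^sup>2) \<partial>lborel) \<le> ennreal (2 * exp (- t) + t * \<eta>)"
proof -
  let ?w = "\<lambda>y. ennreal (1 / y\<^sup>2)"
  let ?I = "\<integral>\<^sup>+x\<in>{0<..exp t * R}. ennreal (\<bar>D t x\<bar> / x\<^sup>2) \<partial>lborel"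
  let ?J = "\<integral>\<^sup>+s\<in>{0..t}. loss R s \<partial>lborel"
  have I: "(\<integral>\<^sup>+y\<in>{0<..R}. ?w y * ennreal \<bar>D t (exp t * y)\<bar> \<partial>lborel) = ennreal (exp t) * ?I"
  proof -
    have "(\<integral>\<^sup>+y\<in>{0<..R}. ?w y * ennreal \<bar>D t (exp t * y)\<bar> \<partial>lborel)
        = (\<integral>\<^sup>+y\<in>{0<..R}. ennreal ((exp t)\<^sup>2) * ennreal (\<bar>D t (exp t * y)\<bar> / (exp t * y)\<^sup>2) \<partial>lborel)"
      by (intro nn_integral_cong) (auto simp: indicator_def power_mult_distrib simp flip: ennreal_mult)
    also have "\<dots> = ennreal (1 / exp t) * (\<integral>\<^sup>+x\<in>{0<..exp t * R}. ennreal ((exp t)\<^sup>2) * ennreal (\<bar>D t x\<bar> / x\<^sup>2) \<partial>lborel)"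
      by (rule nn_integral_scaled_Ioc) auto
    also have "\<dots> = ennreal (1 / exp t) * (ennreal ((exp t)\<^sup>2) * ?I)"
      by (simp add: nn_integral_cmult mult.assoc)
    also have "\<dots> = ennreal (exp t) * ?I"
      by (simp add: power2_eq_square flip: mult.assoc ennreal_mult)
    finally show ?thesis .
  qed
  have "ennreal (exp t) * ?I + ?J
      = (\<integral>\<^sup>+y\<in>{0<..R}. ?w y * ennreal \<bar>D t (exp t * y)\<bar> \<partial>lborel)
        + (\<integral>\<^sup>+y\<in>{0<..R}. ?w y * (\<integral>\<^sup>+s\<in>{0..t}. ennreal (exp s * y * \<bar>\<delta> s (exp s * y)\<bar>) \<partial>lborel) \<partial>lborel)"
    unfolding I nn_integral_loss_term[symmetric] by (subst nn_integral_swap_weighted) auto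
  also have "\<dots> = (\<integral>\<^sup>+y. ?w y * ennreal \<bar>D t (exp t * y)\<bar> * indicator {0<..R} y
      + ?w y * (\<integral>\<^sup>+s\<in>{0..t}. ennreal (exp s * y * \<bar>\<delta> s (exp s * y)\<bar>) \<partial>lborel) * indicator {0<..R} y \<partial>lborel)"
    by (rule nn_integral_add[symmetric]) measurable
  also have "\<dots> \<le> (\<integral>\<^sup>+y. ?w y * ennreal \<bar>D 0 y\<bar> * indicator {0<..R} y
      + ?w y * (\<integral>\<^sup>+s\<in>{0..t}. ennreal ((exp s * y)\<^sup>2 * A s (exp s * y)) \<partial>lborel) * indicator {0<..R} y \<partial>lborel)"
  proof (rule nn_integral_mono)
    fix y
    show "?w y * ennreal \<bar>D t (exp t * y)\<bar> * indicator {0<..R} y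
        + ?w y * (\<integral>\<^sup>+s\<in>{0..t}. ennreal (exp s * y * \<bar>\<delta> s (exp s * y)\<bar>) \<partial>lborel) * indicator {0<..R} y
      \<le> ?w y * ennreal \<bar>D 0 y\<bar> * indicator {0<..R} y
        + ?w y * (\<integral>\<^sup>+s\<in>{0..t}. ennreal ((exp s * y)\<^sup>2 * A s (exp s * y)) \<partial>lborel) * indicator {0<..R} y"
    proof (cases "0 < y \<and> y \<le> R")
      case True
      then show ?thesis
        using mult_left_mono[OF ennreal_difference_along_characteristic[OF t, of y], of "?w y"]
        by (simp add: distrib_left)
    qed (auto simp: indicator_def)
  qed
  also have "\<dots> = (\<integral>\<^sup>+y\<in>{0<..R}. ?w y * ennreal \<bar>D 0 y\<bar> \<partial>lborel)
      + (\<integral>\<^sup>+y\<in>{0<..R}. ?w y * (\<integral>\<^sup>+s\<in>{0..t}. ennreal ((exp s * y)\<^sup>2 * A s (exp s * y)) \<partial>lborel) \<partial>lborel)"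
    by (rule nn_integral_add) measurable
  also have "\<dots> \<le> 2 + (?J + ennreal (exp t * (t * \<eta>)))"
  proof (rule add_mono)
    have "(\<integral>\<^sup>+y\<in>{0<..R}. ?w y * ennreal \<bar>D 0 y\<bar> \<partial>lborel) \<le> (\<integral>\<^sup>+x\<in>{0<..}. ennreal (\<bar>D 0 x\<bar> / x\<^sup>2) \<partial>lborel)"
      by (intro nn_integral_mono) (auto simp: indicator_def simp flip: ennreal_mult)
    also have "\<dots> \<le> 2" by (rule D_norm_le_2)
    finally show "(\<integral>\<^sup>+y\<in>{0<..R}. ?w y * ennreal \<bar>D 0 y\<bar> \<partial>lborel) \<le> 2" .
    have "(\<integral>\<^sup>+y\<in>{0<..R}. ?w y * (\<integral>\<^sup>+s\<in>{0..t}. ennreal ((exp s * y)\<^sup>2 * A s (exp s * y)) \<partial>lborel) \<partial>lborel)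
        = (\<integral>\<^sup>+s\<in>{0..t}. (\<integral>\<^sup>+y\<in>{0<..R}. ?w y * ennreal ((exp s * y)\<^sup>2 * A s (exp s * y)) \<partial>lborel) \<partial>lborel)"
      by (rule nn_integral_swap_weighted) measurable
    also have "\<dots> \<le> (\<integral>\<^sup>+s. loss R s * indicator {0..t} s + ennreal (exp t * \<eta>) * indicator {0..t} s \<partial>lborel)"
    proof (rule nn_integral_mono)
      fix s
      show "(\<integral>\<^sup>+y\<in>{0<..R}. ?w y * ennreal ((exp s * y)\<^sup>2 * A s (exp s * y)) \<partial>lborel) * indicator {0..t} s
          \<le> loss R s * indicator {0..t} s + ennreal (exp t * \<eta>) * indicator {0..t} s"
      proof (cases "s \<in> {0..t}")
        case True
        then have "(\<integral>\<^sup>+y\<in>{0<..R}. ?w y * ennreal ((exp s * y)\<^sup>2 * A s (exp s * y)) \<partial>lborel) \<le> loss R s + ennreal (exp s * \<eta>)"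
          by (intro nn_integral_gain_term R \<eta>) auto
        also have "\<dots> \<le> loss R s + ennreal (exp t * \<eta>)"
          using True \<eta>0 by (intro add_left_mono ennreal_leI mult_right_mono) auto
        finally show ?thesis using True by simp
      qed simp
    qed
    also have "\<dots> = ?J + ennreal (exp t * \<eta>) * ennreal t"
      using t by (subst nn_integral_add) (auto simp: nn_integral_cmult_indicator)
    also have "\<dots> = ?J + ennreal (exp t * (t * \<eta>))"
      using t \<eta>0 by (simp add: mult_ac flip: ennreal_mult)
    finally show "(\<integral>\<^sup>+y\<in>{0<..R}. ?w y * (\<integral>\<^sup>+s\<in>{0..t}. ennreal ((exp s * y)\<^sup>2 * A s (exp s * y)) \<partial>lborel) \<partial>lborel)
        \<le> ?J + ennreal (exp t * (t * \<eta>))" .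
  qed
  finally have "?J + ennreal (exp t) * ?I \<le> ?J + (2 + ennreal (exp t * (t * \<eta>)))"
    by (simp add: ac_simps)
  moreover have "?J \<noteq> top"
  proof -
    have "?J \<le> (\<integral>\<^sup>+s\<in>{0..t}. ennreal (2 * (exp t * (L * (exp t * R)))) \<partial>lborel)"
      using loss_bound[OF R] by (intro nn_integral_mono) (auto simp: indicator_def)
    also have "\<dots> < top" using t by (simp add: nn_integral_cmult_indicator ennreal_mult_less_top)
    finally show ?thesis by simp
  qed
  ultimately have "ennreal (exp t) * ?I \<le> 2 + ennreal (exp t * (t * \<eta>))"
    by (simp add: ennreal_add_left_cancel_le)
  then have "ennreal (exp (- t)) * (ennreal (exp t) * ?I) \<le> ennreal (exp (- t)) * (2 + ennreal (exp t * (t * \<eta>)))"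
    by (rule mult_left_mono) simp
  moreover have "ennreal (exp (- t)) * (ennreal (exp t) * ?I) = ?I"
    by (simp add: exp_minus flip: mult.assoc ennreal_mult)
  moreover have "ennreal (exp (- t)) * (2 + ennreal (exp t * (t * \<eta>))) = ennreal (2 * exp (- t) + t * \<eta>)"
  proof -
    have "ennreal (exp (- t)) * (2 + ennreal (exp t * (t * \<eta>))) = ennreal (exp (- t)) * ennreal (2 + exp t * (t * \<eta>))"
      using t \<eta>0 by simp
    also have "\<dots> = ennreal (exp (- t) * (2 + exp t * (t * \<eta>)))"
      using t \<eta>0 by (intro ennreal_mult[symmetric]) auto
    also have "exp (- t) * (2 + exp t * (t * \<eta>)) = 2 * exp (- t) + t * \<eta>"
      by (simp add: distrib_left exp_minus)
    finally show ?thesis .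
  qed
  ultimately show ?thesis by simp
qed

text \<open>
  Tightness makes both solutions close to \<open>1\<close>, uniformly in time, beyond a common point.
\<close>

lemma \<delta>_small_at_infinity:
  assumes \<eta>: "0 < \<eta>"
  obtains N where "0 < N" "\<And>s z. 0 \<le> s \<Longrightarrow> N < z \<Longrightarrow> \<bar>\<delta> s z\<bar> \<le> \<eta>"
proof -
  have tight: "\<exists>N\<ge>0. \<forall>s\<ge>0. 1 - \<eta> / L < slice H s N" if H: "H \<in> solutions \<Psi>" for H
  proof -
    have "0 < \<eta> / L" using \<eta> L_pos by simp
    moreover have "tight_family H" using H by (simp add: solutions_def)
    ultimately obtain N where "0 \<le> N" "\<forall>t\<ge>0. 1 - \<eta> / L < H t (ennreal N)"
      unfolding tight_family_def by blast
    then show ?thesis by (intro exI[of _ N]) (auto simp: slice_def fin_part_def)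
  qed
  obtain N where N: "0 \<le> N" "\<And>s. 0 \<le> s \<Longrightarrow> 1 - \<eta> / L < slice F s N" using tight[OF F] by blast
  obtain N' where N': "0 \<le> N'" "\<And>s. 0 \<le> s \<Longrightarrow> 1 - \<eta> / L < slice F' s N'" using tight[OF F'] by blast
  show thesis
  proof (rule that[of "max N N' + 1"])
    show "0 < max N N' + 1" using N(1) by simp
    fix s z :: real assume s: "0 \<le> s" and z: "max N N' + 1 < z"
    have "N \<le> z" "N' \<le> z" using z by linarith+
    then have "1 - \<eta> / L < slice F s z" "1 - \<eta> / L < slice F' s z"
      using less_le_trans[OF N(2)[OF s] slice_mono[OF X(1)]] less_le_trans[OF N'(2)[OF s] slice_mono[OF X(2)]] by auto
    then have "\<bar>D s z\<bar> \<le> \<eta> / L"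
      using slice_bounds(2)[OF X(1), of s z] slice_bounds(2)[OF X(2), of s z] unfolding D_def by linarith
    then have "L * \<bar>D s z\<bar> \<le> \<eta>" using L_pos by (simp add: field_simps)
    then show "\<bar>\<delta> s z\<bar> \<le> \<eta>" using \<delta>_Lipschitz[of s z] by linarith
  qed
qed

text \<open>
  Let the cutoff tend to infinity.
\<close>

theorem contraction:
  assumes t: "0 \<le> t"
  shows "norm_xm2 (\<lambda>x. fin_part (F t) x - fin_part (F' t) x) \<le> ennreal (2 * exp (- t))"
proof -
  have "norm_xm2 (\<lambda>x. fin_part (F t) x - fin_part (F' t) x) = (\<integral>\<^sup>+x\<in>{0<..}. ennreal (\<bar>D t x\<bar> / x\<^sup>2) \<partial>lborel)"
    using t by (simp add: norm_xm2_eq_Ioi D_def slice_def)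
  also have "\<dots> \<le> ennreal (2 * exp (- t))"
  proof (rule ennreal_le_epsilon)
    fix e :: real assume e: "0 < e"
    define \<eta> where "\<eta> = e / (t + 1)"
    have \<eta>: "0 < \<eta>" "t * \<eta> \<le> e" using e t by (auto simp: \<eta>_def field_simps)
    obtain N where N: "0 < N" "\<And>s z. 0 \<le> s \<Longrightarrow> N < z \<Longrightarrow> \<bar>\<delta> s z\<bar> \<le> \<eta>"
      by (rule \<delta>_small_at_infinity[OF \<eta>(1)]) blast
    have "(\<integral>\<^sup>+x\<in>{0<..}. ennreal (\<bar>D t x\<bar> / x\<^sup>2) \<partial>lborel) \<le> ennreal (2 * exp (- t) + t * \<eta>)"
    proof (rule nn_integral_Ioi_le_of_Ioc)
      fix b assume b: "exp t * N \<le> b"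
      have cancel: "exp t * (exp (- t) * b) = b" by (simp add: exp_minus)
      from b have "N \<le> exp (- t) * b" by (simp add: exp_minus field_simps)
      with N have "(\<integral>\<^sup>+x\<in>{0<..exp t * (exp (- t) * b)}. ennreal (\<bar>D t x\<bar> / x\<^sup>2) \<partial>lborel) \<le> ennreal (2 * exp (- t) + t * \<eta>)"
        using \<eta> by (intro truncated_contraction t) auto
      then show "(\<integral>\<^sup>+x\<in>{0<..b}. ennreal (\<bar>D t x\<bar> / x\<^sup>2) \<partial>lborel) \<le> ennreal (2 * exp (- t) + t * \<eta>)"
        by (simp only: cancel)
    qed measurable
    also have "\<dots> \<le> ennreal (2 * exp (- t) + e)" using \<eta> by (intro ennreal_leI) auto
    also have "\<dots> = ennreal (2 * exp (- t)) + ennreal e" using e by (simp add: ennreal_plus)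
    finally show "(\<integral>\<^sup>+x\<in>{0<..}. ennreal (\<bar>D t x\<bar> / x\<^sup>2) \<partial>lborel) \<le> ennreal (2 * exp (- t)) + ennreal e" .
  qed
  finally show ?thesis .
qed

end

section \<open>Identification of the limit and the tail asymptotics\<close>

lemma ex_in_interval_if_AE_lborel:
  fixes a b :: real
  assumes "AE x in lborel. Q x" "a < b"
  shows "\<exists>x\<in>{a<..<b}. Q x"
proof (rule ccontr)
  assume "\<not> ?thesis"
  with assms(1) have "AE x in lborel. x \<notin> {a<..<b}" by (auto elim!: eventually_mono)
  then have "emeasure lborel {a<..<b} = 0" by (subst (asm) AE_iff_measurable[where N = "{a<..<b}"]) auto
  then show False using assms(2) by simp
qed

text \<open>
  The norm only sees functions up to null sets; right-continuity recovers all values, that at \<open>0\<close>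
  included.
\<close>

lemma right_continuous_eq_if_norm_xm2_eq_0:
  fixes f g :: "real \<Rightarrow> real"
  assumes [measurable]: "f \<in> borel_measurable borel" "g \<in> borel_measurable borel"
    and rc: "\<And>a. continuous (at_right a) f" "\<And>a. continuous (at_right a) g"
    and norm0: "norm_xm2 (\<lambda>x. f x - g x) = 0" and x: "0 \<le> x"
  shows "f x = g x"
proof (rule ccontr)
  assume "f x \<noteq> g x"
  have "AE z in lborel. ennreal (\<bar>f z - g z\<bar> / z\<^sup>2) * indicator {0<..} z = 0"
    using norm0 unfolding norm_xm2_eq_Ioi by (subst (asm) nn_integral_0_iff_AE) auto
  then have AE: "AE z in lborel. 0 < z \<longrightarrow> f z = g z"
    by eventually_elim (auto simp: indicator_def split: if_splits)
  have "((\<lambda>z. f z - g z) \<longlongrightarrow> f x - g x) (at_right x)"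
    using rc by (intro tendsto_diff) (auto simp: continuous_within)
  then have "\<forall>\<^sub>F z in at_right x. f z - g z \<noteq> 0"
    by (rule tendsto_imp_eventually_ne) (use \<open>f x \<noteq> g x\<close> in simp)
  then obtain b where b: "x < b" "\<And>z. x < z \<Longrightarrow> z < b \<Longrightarrow> f z \<noteq> g z"
    by (auto simp: eventually_at_right_field)
  with ex_in_interval_if_AE_lborel[OF AE b(1)] x show False by auto
qed

lemma choice_function_power:
  assumes "1 \<le> k"
  shows "choice_function (\<lambda>u. u ^ k) (real k)"
proof
  show "\<bar>a ^ k - b ^ k\<bar> \<le> real k * \<bar>a - b\<bar>" if "0 \<le> a" "a \<le> 1" "0 \<le> b" "b \<le> 1" for a b :: real
    using abs_power_diff_le[of a 1 b k] that by simp
qed (use assms in \<open>auto intro: power_mono power_le_one\<close>)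

text \<open>
  The constant family \<open>steady\<close> is itself a solution.  Comparing it with all solutions shows that it
  has the defining property of \<open>F_Psi\<close>, and comparing it with any other candidate shows that it is
  the only function with this property.
\<close>

lemma (in unit_profile) F_Psi_eq_steady: "F_Psi (\<lambda>u. u ^ k) = steady"
  unfolding F_Psi_def
proof (rule the_equality)
  interpret choice_function "\<lambda>u. u ^ k" "real k" by (rule choice_function_power[OF k_ge_1])
  show "distribution_function steady \<and> steady \<in> D1_set \<and>
      (\<forall>F\<in>solutions (\<lambda>u. u ^ k). \<forall>t\<ge>0.
        norm_xm2 (\<lambda>x. fin_part (F t) x - fin_part steady x) \<le> ennreal (2 * exp (- t)))"
  proof (intro conjI ballI allI impI)
    fix F and t :: real assume "F \<in> solutions (\<lambda>u. u ^ k)" "0 \<le> t"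
    then interpret solution_pair "\<lambda>u. u ^ k" "real k" F "\<lambda>_. steady"
      using steady_solution by unfold_locales
    show "norm_xm2 (\<lambda>x. fin_part (F t) x - fin_part steady x) \<le> ennreal (2 * exp (- t))"
      by (rule contraction[OF \<open>0 \<le> t\<close>])
  qed (use steady_distribution_function steady_in_D1_set in auto)
next
  fix H
  assume H: "distribution_function H \<and> H \<in> D1_set \<and>
      (\<forall>F\<in>solutions (\<lambda>u. u ^ k). \<forall>t\<ge>0.
        norm_xm2 (\<lambda>x. fin_part (F t) x - fin_part H x) \<le> ennreal (2 * exp (- t)))"
  then have HD: "H \<in> D_set" by (simp add: D1_set_def)
  have le: "norm_xm2 (\<lambda>x. G x - fin_part H x) \<le> ennreal (2 * exp (- t))" if "0 \<le> t" for t
    using H steady_solution that by (force simp: fin_part_steady)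
  have "((\<lambda>t::real. ennreal (2 * exp (- t))) \<longlongrightarrow> ennreal 0) at_top"
    by (intro tendsto_ennrealI) real_asymp
  then have "norm_xm2 (\<lambda>x. G x - fin_part H x) \<le> ennreal 0"
    by (rule tendsto_lowerbound) (auto intro: eventually_mono[OF eventually_ge_at_top[of 0]] le)
  then have norm0: "norm_xm2 (\<lambda>x. G x - fin_part H x) = 0" by simp
  have meas: "fin_part H \<in> borel_measurable borel"
    by (intro borel_measurable_mono) (auto simp: mono_def fin_part_mono[OF HD])
  have eq: "G x = fin_part H x" if "0 \<le> x" for x
    by (rule right_continuous_eq_if_norm_xm2_eq_0[OF G_borel meas G_right_continuous
          fin_part_right_continuous[OF HD] norm0 that])
  show "H = steady"
  proof
    fix x
    show "H x = steady x"
    proof (cases x)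
      case (real r)
      then show ?thesis using eq[of r] by (simp add: fin_part_def steady_def)
    next
      case top
      then show ?thesis using H by (auto simp: distribution_function_def steady_def)
    qed
  qed
qed

theorem corollary9p3:
  fixes k :: nat
  assumes "k \<ge> 1"
  shows "\<exists>C::real. C > 0 \<and>
           deriv (fin_part (F_Psi (\<lambda>u. u ^ k))) \<sim>[at_top] (\<lambda>x::real. C * x * exp (- real k * x))"
proof -
  obtain G h where "unit_profile k G h" by (rule unit_profile_exists[OF assms])
  then interpret unit_profile k G h .
  show ?thesis unfolding F_Psi_eq_steady fin_part_steady by (rule deriv_G_asymptotics)
qed

end
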